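(* Let $F|K$ be a function field of arbitrary characteristic and $P$ a rational discrete place of $F|K$. Then for every choice of finitely many elements $\zeta_1,\ldots,\zeta_m$ in the valuation ring $\mathcal O_F$ of $P$ on $F$, $(F|K,P)$ is uniformizable with respect to $\zeta_1,\ldots,\zeta_m$.
   Context: "Function field" means a finitely generated field extension of transcendence degree $\geq 1$. A place of $F|K$ is a place of $F$ whose restriction to $K$ is the identity; it is rational if its residue field $FP$ equals $K$, and discrete if its value group is isomorphic to $\mathbb Z$. Uniformizability: let $\mathcal F|\mathcal K$ be a finitely generated field extension and $P$ a place of $\mathcal F$, not necessarily the identity on $\mathcal K$. Let $\mathcal O_{\mathcal F}$, $\mathcal O_{\mathcal K}$ be the valuation rings of $P$ on $\mathcal F$, $\mathcal K$, and write $aP$ for the residue of $a$. For $\zeta_1,\ldots,\zeta_m\in\mathcal O_{\mathcal F}$, $(\mathcal F|\mathcal K,P)$ is uniformizable with respect to $\zeta_1,\ldots,\zeta_m$ if there are a transcendence basis $T=\{t_1,\ldots,t_s\}\subset\mathcal O_{\mathcal F}$ of $\mathcal F|\mathcal K$ (possibly empty), elements $\eta_1,\ldots,\eta_n\in\mathcal O_{\mathcal F}$ among which $\zeta_1,\ldots,\zeta_m$ appear, and polynomials $f_i\in\mathcal O_{\mathcal K}[t_1,\ldots,t_s,X_1,\ldots,X_n]$, $1\le i\le n$, such that $\mathcal F=\mathcal K(t_1,\ldots,t_s,\eta_1,\ldots,\eta_n)$ and: (U1) for $i<j$, $X_j$ does not occur in $f_i$; (U2) $f_i(\eta_1,\ldots,\eta_n)=0$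 for $1\le i\le n$; (U3) $(\det J_f(\eta_1,\ldots,\eta_n))P\neq 0$, where $J_f=(\partial f_i/\partial X_j)_{i,j}$. *)

theory Defs
  imports
    "HOL-Library.Poly_Mapping"
    "HOL-Computational_Algebra.Polynomial"
    "HOL-Algebra.Elementary_Groups"
    "Jordan_Normal_Form.Determinant"
begin

text \<open>
  Throughout, the field \<open>F\<close> is the whole type \<open>'a :: field\<close>, and subrings, subfields
  and the ground field are subsets of it.
\<close>

section \<open>Subrings and subfields\<close>

definition is_subring :: "'a::field set \<Rightarrow> bool" where
  "is_subring R \<longleftrightarrow>
     1 \<in> R \<and> (\<forall>a\<in>R. \<forall>b\<in>R. a - b \<in> R) \<and> (\<forall>a\<in>R. \<forall>b\<in>R. a * b \<in> R)"

definition is_subfield :: "'a::field set \<Rightarrow> bool" where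
  "is_subfield K \<longleftrightarrow> is_subring K \<and> (\<forall>a\<in>K. inverse a \<in> K)"

definition gen_subring :: "'a::field set \<Rightarrow> 'a set" where
  "gen_subring S = \<Inter>{R. is_subring R \<and> S \<subseteq> R}"

definition gen_subfield :: "'a::field set \<Rightarrow> 'a set" where
  "gen_subfield S = \<Inter>{L. is_subfield L \<and> S \<subseteq> L}"


section \<open>Multivariate polynomials\<close>

text \<open>
  Monomials are finitely supported exponent functions on the variables \<open>'v\<close>;
  a polynomial is a finitely supported coefficient function on monomials.
\<close>

type_synonym ('v, 'a) multipoly = "('v \<Rightarrow>\<^sub>0 nat) \<Rightarrow>\<^sub>0 'a"

definition mp_vars :: "('v, 'a::zero) multipoly \<Rightarrow> 'v set" where
  "mp_vars p = (\<Union>m\<in>Poly_Mapping.keys p. Poly_Mapping.keys m)"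

definition mp_over :: "'a::zero set \<Rightarrow> 'v set \<Rightarrow> ('v, 'a) multipoly set" where
  "mp_over R V = {p. (\<forall>m. Poly_Mapping.lookup p m \<in> R) \<and> mp_vars p \<subseteq> V}"

definition mp_eval :: "('v \<Rightarrow> 'a) \<Rightarrow> ('v, 'a::comm_ring_1) multipoly \<Rightarrow> 'a" where
  "mp_eval x p =
     (\<Sum>m\<in>Poly_Mapping.keys p. Poly_Mapping.lookup p m *
        (\<Prod>v\<in>Poly_Mapping.keys m. x v ^ Poly_Mapping.lookup m v))"

text \<open>
  The truncated subtraction of exponents is harmless: where it truncates, the
  coefficient \<open>of_nat (lookup m v)\<close> is zero.
\<close>

definition mp_pderiv :: "'v \<Rightarrow> ('v, 'a::comm_ring_1) multipoly \<Rightarrow> ('v, 'a) multipoly" where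
  "mp_pderiv v p =
     (\<Sum>m\<in>Poly_Mapping.keys p.
        Poly_Mapping.single (m - Poly_Mapping.single v 1)
          (of_nat (Poly_Mapping.lookup m v) * Poly_Mapping.lookup p m))"


section \<open>Function fields\<close>

definition algebraic_over :: "'a::field set \<Rightarrow> 'a \<Rightarrow> bool" where
  "algebraic_over L x \<longleftrightarrow>
     (\<exists>p :: 'a poly. p \<noteq> 0 \<and> (\<forall>i. coeff p i \<in> L) \<and> poly p x = 0)"

text \<open>Here the elements of \<open>T\<close> serve as names for their own variables.\<close>

definition alg_independent :: "'a::field set \<Rightarrow> 'a set \<Rightarrow> bool" where
  "alg_independent K T \<longleftrightarrow> (\<forall>p \<in> mp_over K T. mp_eval (\<lambda>t. t) p = 0 \<longrightarrow> p = 0)"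

definition transcendence_basis :: "'a::field set \<Rightarrow> 'a set \<Rightarrow> bool" where
  "transcendence_basis K T \<longleftrightarrow>
     alg_independent K T \<and> (\<forall>x. algebraic_over (gen_subfield (K \<union> T)) x)"

definition fin_gen_over :: "'a::field set \<Rightarrow> bool" where
  "fin_gen_over K \<longleftrightarrow> (\<exists>S. finite S \<and> gen_subfield (K \<union> S) = UNIV)"

text \<open>
  Only meaningful when a finite transcendence basis exists, as for finitely generated
  extensions; all transcendence bases then have the same cardinality.
\<close>

definition transcendence_degree :: "'a::field set \<Rightarrow> nat" where
  "transcendence_degree K = (LEAST n. \<exists>T. transcendence_basis K T \<and> finite T \<and> card T = n)"

definition function_field :: "'a::field set \<Rightarrow> bool" where
  "function_field K \<longleftrightarrow> is_subfield K \<and> fin_gen_over K \<and> transcendence_degree K \<ge> 1"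


section \<open>Places\<close>

text \<open>
  A place with values in a field \<open>'b\<close>; the value \<open>None\<close> is the symbol \<open>\<infinity>\<close>.
\<close>

definition place :: "('a::field \<Rightarrow> 'b::field option) \<Rightarrow> bool" where
  "place P \<longleftrightarrow>
     P 1 = Some 1 \<and>
     (\<forall>a b c d. P a = Some c \<longrightarrow> P b = Some d \<longrightarrow>
        P (a - b) = Some (c - d) \<and> P (a * b) = Some (c * d)) \<and>
     (\<forall>a. P a = None \<longrightarrow> P (inverse a) = Some 0)"

definition val_ring :: "('a::field \<Rightarrow> 'b::field option) \<Rightarrow> 'a set" where
  "val_ring P = {a. P a \<noteq> None}"

definition residue_field :: "('a::field \<Rightarrow> 'b::field option) \<Rightarrow> 'b set" where
  "residue_field P = {b. \<exists>a. P a = Some b}"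

text \<open>
  For a place of \<open>F|K\<close>, the residue field contains \<open>K\<close> itself. If the place is moreover
  rational, all its finite values lie in \<open>K\<close>, hence in the type \<open>'a\<close>. So rational places of
  \<open>F|K\<close> are exactly maps of the following type.
\<close>

definition rational_place_over :: "'a::field set \<Rightarrow> ('a \<Rightarrow> 'a option) \<Rightarrow> bool" where
  "rational_place_over K P \<longleftrightarrow>
     place P \<and> (\<forall>a\<in>K. P a = Some a) \<and> residue_field P = K"

definition mult_group_of_field :: "'a::field monoid" where
  "mult_group_of_field = \<lparr>carrier = UNIV - {0}, monoid.mult = (*), one = 1\<rparr>"

definition val_ring_units :: "('a::field \<Rightarrow> 'b::field option) \<Rightarrow> 'a set" where
  "val_ring_units P = {a. a \<noteq> 0 \<and> a \<in> val_ring P \<and> inverse a \<in> val_ring P}"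

definition value_group :: "('a::field \<Rightarrow> 'b::field option) \<Rightarrow> 'a set monoid" where
  "value_group P = mult_group_of_field Mod val_ring_units P"

text \<open>
  It makes no difference whether the isomorphism is required to respect the orderings: the
  only orderings of the group \<open>\<int>\<close> are the usual one and its opposite, interchanged by negation.
\<close>

definition discrete_place :: "('a::field \<Rightarrow> 'b::field option) \<Rightarrow> bool" where
  "discrete_place P \<longleftrightarrow> value_group P \<cong> integer_group"


section \<open>Uniformizability\<close>

text \<open>
  \<open>R[t\<^sub>1,\<dots>,t\<^sub>s,X\<^sub>1,\<dots>,X\<^sub>n]\<close> is the set of polynomials in \<open>X\<^sub>1,\<dots>,X\<^sub>n\<close> with
  coefficients in the subring \<open>R[t\<^sub>1,\<dots>,t\<^sub>s]\<close> of \<open>F\<close>. Indices of \<open>\<eta>\<close>, \<open>f\<close> and \<open>X\<close>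
  run through \<open>0,\<dots>,n - 1\<close>.
\<close>

definition uniformizable :: "'a::field set \<Rightarrow> ('a \<Rightarrow> 'b::field option) \<Rightarrow> 'a list \<Rightarrow> bool" where
  "uniformizable K P \<zeta>s \<longleftrightarrow>
     (\<exists>(T :: 'a set) (\<eta>s :: 'a list) (f :: nat \<Rightarrow> (nat, 'a) multipoly).
        let n = length \<eta>s; \<eta> = (\<lambda>i. \<eta>s ! i) in
        finite T \<and> T \<subseteq> val_ring P \<and> transcendence_basis K T \<and>
        set \<eta>s \<subseteq> val_ring P \<and> set \<zeta>s \<subseteq> set \<eta>s \<and>
        (\<forall>i<n. f i \<in> mp_over (gen_subring ((K \<inter> val_ring P) \<union> T)) {..<n}) \<and>
        gen_subfield (K \<union> T \<union> set \<eta>s) = UNIV \<and>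
        (\<forall>i<n. \<forall>j<n. i < j \<longrightarrow> j \<notin> mp_vars (f i)) \<and>
        (\<forall>i<n. mp_eval \<eta> (f i) = 0) \<and>
        P (det (mat n n (\<lambda>(i, j). mp_eval \<eta> (mp_pderiv j (f i))))) \<noteq> Some 0)"

end

theory Submission
  imports "HOL-Algebra.Finite_Extensions" Defs
begin

text \<open>
  Let \<open>t\<close> be a uniformizer and \<open>x\<^sub>1, \<dots>, x\<^sub>n\<close> elements of the valuation ring that generate \<open>F\<close> over
  \<open>K(t)\<close> and contain the given \<open>\<zeta>\<^sub>j\<close>. As long as \<open>t\<close> and the \<open>x\<^sub>i\<close> are algebraically dependent over
  \<open>K\<close>, some \<open>x\<^sub>i\<close> is a simple root of a polynomial over the ring generated by \<open>t\<close> and the others: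
  a relation of minimal degree has a nonzero derivative with respect to some \<open>x\<^sub>i\<close>, since otherwise,
  in characteristic \<open>p\<close>, it has the form \<open>\<Sum> c\<^sub>m t\<^sup>j u\<^sub>m\<^sup>p\<close> with \<open>j < p\<close> depending on \<open>m\<close> and monomials
  \<open>u\<^sub>m\<close>, and comparing valuations (the residue field is \<open>K\<close>) gives a \<open>K\<close>-linear relation between
  the \<open>u\<^sub>m\<close>, of smaller degree. So the \<open>x\<^sub>i\<close> can be ordered such that \<open>t, x\<^sub>1, \<dots>, x\<^sub>s\<close> are algebraically
  independent and each later \<open>x\<^sub>i\<close> is a simple root of a polynomial over \<open>K[t, x\<^sub>1, \<dots>, x\<^bsub>i-1\<^esub>]\<close>.

  The derivatives at these roots need not be units. Because every element of the valuation ring is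
  congruent modulo any power of \<open>t\<close> to a polynomial in \<open>t\<close>, one can write \<open>x\<^sub>i = a\<^sub>i + t\<^sup>M y\<^sub>i\<close> with
  \<open>a\<^sub>i \<in> K[t]\<close> and an exponent \<open>M\<close> depending on \<open>i\<close>. If these exponents are large and decrease fast
  enough, then each equation, rewritten in the \<open>y\<^sub>i\<close> and divided by a power of \<open>t\<close>, has unit
  derivative at \<open>y\<^sub>i\<close>. The transcendence basis is \<open>t, y\<^sub>1, \<dots>, y\<^sub>s\<close>; the \<open>\<zeta>\<^sub>j\<close> are adjoined at the
  end by linear equations.
\<close>

section \<open>Subrings, subfields and algebraic elements\<close>

lemma is_subringD:
  assumes "is_subring R"
  shows is_subring_one: "1 \<in> R" and is_subring_zero: "0 \<in> R"
    and is_subring_diff: "\<And>a b. a \<in> R \<Longrightarrow> b \<in> R \<Longrightarrow> a - b \<in> R"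
    and is_subring_uminus: "\<And>a. a \<in> R \<Longrightarrow> - a \<in> R"
    and is_subring_add: "\<And>a b. a \<in> R \<Longrightarrow> b \<in> R \<Longrightarrow> a + b \<in> R"
    and is_subring_mult: "\<And>a b. a \<in> R \<Longrightarrow> b \<in> R \<Longrightarrow> a * b \<in> R"
proof -
  show one: "1 \<in> R" and diff: "\<And>a b. a \<in> R \<Longrightarrow> b \<in> R \<Longrightarrow> a - b \<in> R"
    and "\<And>a b. a \<in> R \<Longrightarrow> b \<in> R \<Longrightarrow> a * b \<in> R"
    using assms by (auto simp: is_subring_def)
  show zero: "0 \<in> R"
    using diff[OF one one] by simp
  show uminus: "- a \<in> R" if "a \<in> R" for a
    using diff[OF zero that] by simp
  show "a + b \<in> R" if "a \<in> R" "b \<in> R" for a b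
    using diff[OF that(1) uminus[OF that(2)]] by simp
qed

lemma is_subring_power: "is_subring R \<Longrightarrow> a \<in> R \<Longrightarrow> a ^ n \<in> R"
  by (induction n) (auto intro: is_subringD)

lemma is_subring_sum: "is_subring R \<Longrightarrow> (\<And>i. i \<in> I \<Longrightarrow> f i \<in> R) \<Longrightarrow> sum f I \<in> R"
  by (induction I rule: infinite_finite_induct) (auto intro: is_subringD)

lemma is_subring_prod: "is_subring R \<Longrightarrow> (\<And>i. i \<in> I \<Longrightarrow> f i \<in> R) \<Longrightarrow> prod f I \<in> R"
  by (induction I rule: infinite_finite_induct) (auto intro: is_subringD)

lemma is_subring_of_nat: "is_subring R \<Longrightarrow> of_nat n \<in> R"
  by (induction n) (auto intro: is_subringD)

lemma is_subfieldD:
  assumes "is_subfield L"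
  shows is_subfield_subring: "is_subring L" and is_subfield_inverse: "\<And>a. a \<in> L \<Longrightarrow> inverse a \<in> L"
    and is_subfield_divide: "\<And>a b. a \<in> L \<Longrightarrow> b \<in> L \<Longrightarrow> a / b \<in> L"
  using assms by (auto simp: is_subfield_def divide_inverse intro: is_subring_mult)

lemma gen_subring_is_subring: "is_subring (gen_subring S)"
  by (auto simp: gen_subring_def is_subring_def)

lemma gen_subring_incl: "S \<subseteq> gen_subring S"
  by (auto simp: gen_subring_def)

lemma gen_subring_least: "is_subring R \<Longrightarrow> S \<subseteq> R \<Longrightarrow> gen_subring S \<subseteq> R"
  by (auto simp: gen_subring_def)

lemma gen_subring_mono: "S \<subseteq> S' \<Longrightarrow> gen_subring S \<subseteq> gen_subring S'"
  by (auto simp: gen_subring_def)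

lemma gen_subfield_is_subfield: "is_subfield (gen_subfield S)"
  by (auto simp: gen_subfield_def is_subfield_def is_subring_def)

lemma gen_subfield_incl: "S \<subseteq> gen_subfield S"
  by (auto simp: gen_subfield_def)

lemma gen_subfield_least: "is_subfield L \<Longrightarrow> S \<subseteq> L \<Longrightarrow> gen_subfield S \<subseteq> L"
  by (auto simp: gen_subfield_def)

lemma gen_subring_subset_gen_subfield: "gen_subring S \<subseteq> gen_subfield S"
  by (intro gen_subring_least is_subfield_subring gen_subfield_is_subfield gen_subfield_incl)

lemma gen_subfield_eq_fractions:
  "gen_subfield S = {a / b |a b. a \<in> gen_subring S \<and> b \<in> gen_subring S \<and> b \<noteq> 0}" (is "_ = ?Q")
proof
  note R = gen_subring_is_subring[of S]
  have "is_subring ?Q"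
    unfolding is_subring_def
  proof (intro conjI ballI)
    show "1 \<in> ?Q"
      using is_subring_one[OF R] by (intro CollectI exI[of _ 1]) auto
  next
    fix x y assume "x \<in> ?Q" "y \<in> ?Q"
    then obtain a b c d where *: "x = a / b" "y = c / d" "a \<in> gen_subring S" "b \<in> gen_subring S"
      "c \<in> gen_subring S" "d \<in> gen_subring S" "b \<noteq> 0" "d \<noteq> 0" by blast
    have eq: "x - y = (a * d - c * b) / (b * d)" "x * y = (a * c) / (b * d)" and nz: "b * d \<noteq> 0"
      using * by (simp_all add: diff_frac_eq)
    have in_S: "a * d - c * b \<in> gen_subring S" "a * c \<in> gen_subring S" "b * d \<in> gen_subring S"
      using * by (blast intro: is_subringD[OF R])+
    show "x - y \<in> ?Q"
      using eq(1) nz in_S(1,3) by (intro CollectI exI conjI)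
    show "x * y \<in> ?Q"
      using eq(2) nz in_S(2,3) by (intro CollectI exI conjI)
  qed
  moreover have "inverse x \<in> ?Q" if x: "x \<in> ?Q" for x
  proof -
    obtain a b where *: "x = a / b" "a \<in> gen_subring S" "b \<in> gen_subring S" "b \<noteq> 0"
      using x by blast
    show ?thesis
    proof (cases "a = 0")
      case True
      \<comment> \<open>Since \<open>inverse 0 = 0\<close>, a fraction with numerator zero is its
        own inverse.\<close>
      then have "inverse x = a / b" using * by simp
      then show ?thesis using * by blast
    next
      case False
      then have "inverse x = b / a" using * by simp
      then show ?thesis using * False by blast
    qed
  qed
  ultimately have "is_subfield ?Q"
    by (auto simp: is_subfield_def)
  moreover have "S \<subseteq> ?Q"
  proof
    fix x assume "x \<in> S"
    then show "x \<in> ?Q"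
      using gen_subring_incl is_subring_one[OF R]
      by (intro CollectI exI[of _ x] exI[of _ 1]) auto
  qed
  ultimately show "gen_subfield S \<subseteq> ?Q"
    by (rule gen_subfield_least)
  show "?Q \<subseteq> gen_subfield S"
    using gen_subring_subset_gen_subfield[of S]
      is_subfield_divide[OF gen_subfield_is_subfield[of S]] by blast
qed

section \<open>Algebraic elements, by transfer from HOL-Algebra\<close>

context
begin

private definition R :: "'a::field ring" where
  "R = \<lparr>carrier = UNIV, monoid.mult = (*), one = 1, zero = 0, add = (+)\<rparr>"

interpretation R: Ring.field R
proof -
  have "\<exists>y. x + y = 0" for x :: 'a
    using add.right_inverse by blast
  moreover have "x \<noteq> 0 \<Longrightarrow> \<exists>y. x * y = 1" for x :: 'a
    by (rule exI[of _ "inverse x"]) auto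
  ultimately show "Ring.field (R :: 'a ring)"
    unfolding R_def using add.right_inverse
    by unfold_locales (auto simp: algebra_simps Units_def)
qed

private lemma R_simps [simp]:
  "carrier R = UNIV" "x \<otimes>\<^bsub>R\<^esub> y = x * y" "x \<oplus>\<^bsub>R\<^esub> y = x + y" "\<one>\<^bsub>R\<^esub> = 1" "\<zero>\<^bsub>R\<^esub> = 0"
  for x y :: "'a::field"
  by (simp_all add: R_def)

private lemma R_pow [simp]: "x [^]\<^bsub>R\<^esub> (n::nat) = x ^ n" for x :: "'a::field"
  by (induction n) (simp_all add: ac_simps)

private lemma R_uminus [simp]: "\<ominus>\<^bsub>R\<^esub> x = - x" for x :: "'a::field"
  using R.minus_unique[of x "- x"] by (metis R.add.inv_equality R_simps(1,3,5) UNIV_I add.left_inverse)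

private lemma R_inv [simp]: "x \<noteq> 0 \<Longrightarrow> inv\<^bsub>R\<^esub> x = inverse x" for x :: "'a::field"
  by (rule R.inv_char) auto

private lemma subfield_iff: "Subrings.subfield L R \<longleftrightarrow> is_subfield L" for L :: "'a::field set"
proof
  assume *: "Subrings.subfield L R"
  then interpret L: Subrings.subfield L R .
  note sr = Subrings.subfieldE[OF *]
  note sr' = Subrings.subringE[OF sr(1)]
  have "a - b \<in> L" if "a \<in> L" "b \<in> L" for a b
    using sr'(7)[OF that(1) sr'(5)[OF that(2)]] by simp
  moreover have "inverse a \<in> L" if "a \<in> L" for a
    using R.subfield_m_inv(1)[OF *, of a] that sr'(2) by (cases "a = 0") auto
  ultimately show "is_subfield L"
    unfolding is_subfield_def is_subring_def using sr' by auto
next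
  assume *: "is_subfield L"
  show "Subrings.subfield L R"
    using is_subfieldD[OF *] is_subringD[OF is_subfield_subring[OF *]]
    by (intro R.subfieldI' R.subringI) auto
qed

text \<open>HOL-Algebra lists coefficients from the leading one downwards, \<open>Poly\<close> from
  the constant one upwards; hence the reversal.\<close>

private lemma eval_eq: "R.eval p x = poly (Poly (rev p)) x" for x :: "'a::field"
proof (induction p)
  case (Cons a p)
  have "Poly (rev p @ [a]) = Poly (rev p) + monom a (length p)"
    by (rule poly_eqI) (auto simp: nth_default_def nth_append)
  then show ?case
    using Cons by (simp add: poly_monom)
qed simp

text \<open>A nonempty list polynomial has a nonzero head, which becomes the coefficient at
  \<open>length p - 1\<close>. So nonzero polynomials correspond to each other in both
  directions.\<close>

private lemma algebraic_iff:
  assumes "is_subfield L"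
  shows "(R.algebraic over L) x \<longleftrightarrow> algebraic_over L x"
proof
  assume "(R.algebraic over L) x"
  moreover have "Subrings.subring L R"
    using assms subfield_iff Subrings.subfieldE(1) by blast
  ultimately obtain p where p: "p \<in> carrier (L [X]\<^bsub>R\<^esub>)" "p \<noteq> []" "R.eval p x = 0"
    using R.algebraicE[of L x] by auto
  then have sp: "set p \<subseteq> L" "hd p \<noteq> 0"
    by (auto simp: univ_poly_carrier[symmetric] polynomial_def)
  define q where "q = Poly (rev p)"
  have "coeff q i \<in> L" for i
    using sp(1) is_subring_zero[OF is_subfield_subring[OF assms]]
    by (auto simp: q_def nth_default_def rev_nth)
  moreover have "coeff q (length p - 1) = hd p"
    using p(2) by (simp add: q_def nth_default_def rev_nth hd_conv_nth)
  moreover from this have "q \<noteq> 0"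
    using sp(2) by auto
  ultimately show "algebraic_over L x"
    using p(3) by (auto simp: algebraic_over_def eval_eq q_def)
next
  assume "algebraic_over L x"
  then obtain q where q: "q \<noteq> 0" "\<And>i. coeff q i \<in> L" "poly q x = 0"
    by (auto simp: algebraic_over_def)
  define p where "p = rev (coeffs q)"
  have "p \<noteq> []" "hd p \<noteq> 0"
    using q(1) by (simp_all add: p_def hd_rev last_coeffs_eq_coeff_degree)
  moreover have "set p \<subseteq> L"
    using q(2) by (auto simp: p_def coeffs_def)
  ultimately have "p \<in> carrier (L [X]\<^bsub>R\<^esub>)"
    by (auto simp: univ_poly_carrier[symmetric] polynomial_def)
  moreover have "R.eval p x = 0"
    using q(3) by (simp add: eval_eq p_def)
  ultimately show "(R.algebraic over L) x"
    using \<open>p \<noteq> []\<close> by (intro R.algebraicI[of p]) auto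
qed

lemma algebraic_elements_is_subfield:
  fixes L :: "'a::field set"
  assumes "is_subfield L"
  shows "is_subfield {x. algebraic_over L x}"
  using R.subfield_of_algebraics[of L] assms by (simp add: subfield_iff algebraic_iff)

lemma algebraic_over_mono: "algebraic_over L x \<Longrightarrow> L \<subseteq> L' \<Longrightarrow> algebraic_over L' x"
  by (auto simp: algebraic_over_def)

lemma algebraic_over_base:
  assumes "is_subring L" "x \<in> L"
  shows "algebraic_over L x"
  unfolding algebraic_over_def
proof (intro exI conjI allI)
  show "[:- x, 1:] \<noteq> 0" by simp
  show "coeff [:- x, 1:] i \<in> L" for i
    using is_subringD[OF assms(1)] assms(2) by (auto simp: coeff_pCons split: nat.splits)
qed simp

text \<open>The coefficients of an equation for \<open>x\<close> lie in a finite extension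
  \<open>E\<close> of \<open>L\<close>. Adjoining \<open>x\<close> to \<open>E\<close> keeps the
  dimension over \<open>L\<close> finite, and elements of finite-dimensional extensions are
  algebraic.\<close>

lemma algebraic_over_trans:
  fixes L :: "'a::field set"
  assumes L: "is_subfield L" and x: "algebraic_over {y. algebraic_over L y} x"
  shows "algebraic_over L x"
proof -
  obtain q where q: "q \<noteq> 0" "\<And>i. algebraic_over L (coeff q i)" "poly q x = 0"
    using x by (auto simp: algebraic_over_def[of "Collect _"])
  define E where "E = R.finite_extension L (coeffs q)"
  have LR: "Subrings.subfield L R" using L by (simp add: subfield_iff)
  have alg: "\<And>a. a \<in> set (coeffs q) \<Longrightarrow> (R.algebraic over L) a"
    using q(2) by (auto simp: algebraic_iff[OF L] coeffs_def split: if_splits)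
  have E: "Subrings.subfield E R" "R.finite_dimension L E"
    unfolding E_def using R.finite_extension_is_subfield[OF LR _ alg]
      R.finite_extension_finite_dimension(1)[OF LR _ alg] by auto
  have "set (coeffs q) \<subseteq> E"
    unfolding E_def by (intro R.finite_extension_mem Subrings.subfieldE(1)[OF LR]) auto
  moreover have "0 \<in> E"
    using E(1) is_subring_zero[OF is_subfield_subring] by (auto simp: subfield_iff)
  ultimately have "coeff q i \<in> E" for i
    by (metis coeff_in_coeffs coeff_0 coeff_eq_0 le_less_linear subset_iff)
  then have "algebraic_over E x"
    using q by (auto simp: algebraic_over_def)
  then have xE: "(R.algebraic over E) x"
    using E(1) by (simp add: algebraic_iff subfield_iff)
  have "R.finite_dimension E (R.simple_extension E x)"
    using R.finite_dimension_simple_extension[OF E(1), of x] xE by simp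
  then have "R.finite_dimension L (R.simple_extension E x)"
    using R.telescopic_base_dim(1)[OF LR E(1) E(2)] by blast
  then have "(R.algebraic over L) x"
    using R.finite_dimension_imp_algebraic[OF LR R.simple_extension_is_subring[OF Subrings.subfieldE(1)[OF E(1)]]]
      R.simple_extension_mem[OF Subrings.subfieldE(1)[OF E(1)]] by auto
  then show ?thesis
    by (simp add: algebraic_iff[OF L])
qed

end

section \<open>Polynomials over a subring\<close>

lemma pderiv_sum: "pderiv (\<Sum>i\<in>I. f i) = (\<Sum>i\<in>I. pderiv (f i))"
  by (induction I rule: infinite_finite_induct) (simp_all add: pderiv_add)

definition polys_over :: "'a::field set \<Rightarrow> 'a poly set" where
  "polys_over R = {p. \<forall>i. coeff p i \<in> R}"

context
  fixes R :: "'a::field set"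
  assumes R: "is_subring R"
begin

lemma polys_over_0: "0 \<in> polys_over R"
  using is_subring_zero[OF R] by (simp add: polys_over_def)

lemma polys_over_add: "p \<in> polys_over R \<Longrightarrow> q \<in> polys_over R \<Longrightarrow> p + q \<in> polys_over R"
  by (auto simp: polys_over_def intro: is_subring_add[OF R])

lemma polys_over_smult: "c \<in> R \<Longrightarrow> p \<in> polys_over R \<Longrightarrow> smult c p \<in> polys_over R"
  by (auto simp: polys_over_def intro: is_subring_mult[OF R])

lemma polys_over_mult: "p \<in> polys_over R \<Longrightarrow> q \<in> polys_over R \<Longrightarrow> p * q \<in> polys_over R"
  by (auto simp: polys_over_def coeff_mult intro!: is_subring_mult[OF R] is_subring_sum[OF R])

lemma polys_over_pCons: "pCons c p \<in> polys_over R \<longleftrightarrow> c \<in> R \<and> p \<in> polys_over R"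
proof
  assume *: "pCons c p \<in> polys_over R"
  then have "coeff (pCons c p) 0 \<in> R" "coeff (pCons c p) (Suc i) \<in> R" for i
    unfolding polys_over_def by blast+
  then show "c \<in> R \<and> p \<in> polys_over R" by (simp add: polys_over_def)
qed (auto simp: polys_over_def coeff_pCons split: nat.split)

lemma polys_over_pcompose: "p \<in> polys_over R \<Longrightarrow> q \<in> polys_over R \<Longrightarrow> pcompose p q \<in> polys_over R"
proof (induction p)
  case (pCons c p)
  then show ?case
    by (auto simp: pcompose_pCons polys_over_pCons polys_over_0 intro!: polys_over_add polys_over_mult)
qed (simp add: polys_over_0)

lemma polys_over_pderiv: "p \<in> polys_over R \<Longrightarrow> pderiv p \<in> polys_over R"
  unfolding polys_over_def by (auto simp: coeff_pderiv simp del: of_nat_Suc intro!: is_subring_mult[OF R] is_subring_of_nat[OF R])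

lemma poly_in_subring: "p \<in> polys_over R \<Longrightarrow> x \<in> R \<Longrightarrow> poly p x \<in> R"
  by (auto simp: polys_over_def poly_altdef intro!: is_subring_sum[OF R] is_subring_mult[OF R] is_subring_power[OF R])

end

lemma polys_over_mono: "R \<subseteq> R' \<Longrightarrow> p \<in> polys_over R \<Longrightarrow> p \<in> polys_over R'"
  by (auto simp: polys_over_def)

section \<open>Evaluation of multivariate polynomials\<close>

definition mon :: "('v \<Rightarrow> 'a::comm_ring_1) \<Rightarrow> ('v \<Rightarrow>\<^sub>0 nat) \<Rightarrow> 'a" where
  "mon x m = (\<Prod>v\<in>Poly_Mapping.keys m. x v ^ Poly_Mapping.lookup m v)"

text \<open>Exponents outside the support are zero and contribute factors one. This lets monomials
  with different supports be compared over a common index set.\<close>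

lemma mon_superset:
  assumes "finite A" "Poly_Mapping.keys m \<subseteq> A"
  shows "mon x m = (\<Prod>v\<in>A. x v ^ Poly_Mapping.lookup m v)"
  unfolding mon_def using assms by (intro prod.mono_neutral_left) (auto simp: in_keys_iff)

lemma mon_0 [simp]: "mon x 0 = 1"
  by (simp add: mon_def)

lemma mon_single [simp]: "mon x (Poly_Mapping.single v k) = x v ^ k"
  by (subst mon_superset[of "{v}"]) auto

lemma mon_add: "mon x (m + n) = mon x m * mon x n"
proof -
  define A where "A = Poly_Mapping.keys m \<union> Poly_Mapping.keys n"
  have "finite A" "Poly_Mapping.keys m \<subseteq> A" "Poly_Mapping.keys n \<subseteq> A"
    "Poly_Mapping.keys (m + n) \<subseteq> A"
    using keys_add[of m n] by (auto simp: A_def)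
  then show ?thesis
    by (simp add: mon_superset[of A] lookup_add power_add prod.distrib)
qed

lemma single_add_diff:
  fixes m :: "'v \<Rightarrow>\<^sub>0 nat"
  assumes "k \<le> Poly_Mapping.lookup m v"
  shows "m - Poly_Mapping.single v k + Poly_Mapping.single v k = m"
  by (rule poly_mapping_eqI) (use assms in \<open>auto simp: lookup_add lookup_minus lookup_single when_def\<close>)

lemma mp_eval_superset:
  assumes "finite A" "Poly_Mapping.keys p \<subseteq> A"
  shows "mp_eval x p = (\<Sum>m\<in>A. Poly_Mapping.lookup p m * mon x m)"
  unfolding mp_eval_def mon_def[symmetric]
  using assms by (intro sum.mono_neutral_left) (auto simp: in_keys_iff)

lemma mp_eval_0 [simp]: "mp_eval x 0 = 0"
  by (simp add: mp_eval_def)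

lemma mp_eval_single [simp]: "mp_eval x (Poly_Mapping.single m c) = c * mon x m"
  by (subst mp_eval_superset[of "{m}"]) auto

lemma mp_eval_add: "mp_eval x (p + q) = mp_eval x p + mp_eval x q"
proof -
  define A where "A = Poly_Mapping.keys p \<union> Poly_Mapping.keys q"
  have "finite A" "Poly_Mapping.keys p \<subseteq> A" "Poly_Mapping.keys q \<subseteq> A"
    "Poly_Mapping.keys (p + q) \<subseteq> A"
    using keys_add[of p q] by (auto simp: A_def)
  then show ?thesis
    by (simp add: mp_eval_superset[of A] lookup_add sum.distrib algebra_simps)
qed

lemma mp_eval_sum: "mp_eval x (sum p I) = (\<Sum>i\<in>I. mp_eval x (p i))"
  by (induction I rule: infinite_finite_induct) (simp_all add: mp_eval_add)

lemma mp_eval_uminus: "mp_eval x (- p) = - mp_eval x p"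
  using mp_eval_add[of x p "- p"] by (simp add: eq_neg_iff_add_eq_0 add.commute)

lemma mp_eval_diff: "mp_eval x (p - q) = mp_eval x p - mp_eval x q"
  using mp_eval_add[of x p "- q"] by (simp add: mp_eval_uminus)

lemma mp_expand: "p = (\<Sum>m\<in>Poly_Mapping.keys p. Poly_Mapping.single m (Poly_Mapping.lookup p m))"
  by (rule poly_mapping_eqI)
    (auto simp: lookup_sum lookup_single when_def sum.delta in_keys_iff
          cong: if_cong)

lemma mp_mult_expand:
  fixes p q :: "('v, 'a::comm_ring_1) multipoly"
  shows "p * q = (\<Sum>m\<in>Poly_Mapping.keys p. \<Sum>n\<in>Poly_Mapping.keys q.
    Poly_Mapping.single (m + n) (Poly_Mapping.lookup p m * Poly_Mapping.lookup q n))"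
  by (subst mp_expand[of p], subst mp_expand[of q]) (simp add: sum_product mult_single)

lemma mp_eval_mult: "mp_eval x (p * q) = mp_eval x p * mp_eval x q"
proof -
  have "mp_eval x (p * q) = (\<Sum>m\<in>Poly_Mapping.keys p. \<Sum>n\<in>Poly_Mapping.keys q.
      Poly_Mapping.lookup p m * mon x m * (Poly_Mapping.lookup q n * mon x n))"
    by (simp add: mp_mult_expand mp_eval_sum mon_add algebra_simps)
  also have "\<dots> = mp_eval x p * mp_eval x q"
    by (simp add: mp_eval_def mon_def[symmetric] sum_product)
  finally show ?thesis .
qed

lemma mp_over_iff:
  "p \<in> mp_over R V \<longleftrightarrow> (\<forall>m. Poly_Mapping.lookup p m \<in> R) \<and>
     (\<forall>m\<in>Poly_Mapping.keys p. Poly_Mapping.keys m \<subseteq> V)"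
  by (auto simp: mp_over_def mp_vars_def)

lemma mp_over_mono: "p \<in> mp_over R V \<Longrightarrow> R \<subseteq> R' \<Longrightarrow> V \<subseteq> V' \<Longrightarrow> p \<in> mp_over R' V'"
  by (auto simp: mp_over_def)

section \<open>Polynomials over a subring and the rings generated by their values\<close>

context
  fixes R :: "'a::field set"
  assumes R: "is_subring R"
begin

lemma mp_over_0: "0 \<in> mp_over R V"
  using is_subring_zero[OF R] by (simp add: mp_over_iff)

lemma mp_over_single: "c \<in> R \<Longrightarrow> Poly_Mapping.keys m \<subseteq> V \<Longrightarrow> Poly_Mapping.single m c \<in> mp_over R V"
  using is_subring_zero[OF R] by (auto simp: mp_over_iff lookup_single when_def)

lemma mp_over_add: "p \<in> mp_over R V \<Longrightarrow> q \<in> mp_over R V \<Longrightarrow> p + q \<in> mp_over R V"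
  using keys_add[of p q] unfolding mp_over_iff lookup_add by (blast intro: is_subring_add[OF R])

lemma mp_over_uminus: "p \<in> mp_over R V \<Longrightarrow> - p \<in> mp_over R V"
  by (auto simp: mp_over_iff in_keys_iff intro: is_subring_uminus[OF R])

lemma mp_over_sum: "(\<And>i. i \<in> I \<Longrightarrow> p i \<in> mp_over R V) \<Longrightarrow> sum p I \<in> mp_over R V"
  by (induction I rule: infinite_finite_induct) (auto intro: mp_over_0 mp_over_add)

lemma mp_over_mult:
  assumes "p \<in> mp_over R V" "q \<in> mp_over R V"
  shows "p * q \<in> mp_over R V"
  unfolding mp_mult_expand
proof (intro mp_over_sum mp_over_single)
  fix m n assume *: "m \<in> Poly_Mapping.keys p" "n \<in> Poly_Mapping.keys q"
  show "Poly_Mapping.lookup p m * Poly_Mapping.lookup q n \<in> R"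
    using assms by (auto simp: mp_over_iff intro: is_subring_mult[OF R])
  show "Poly_Mapping.keys (m + n) \<subseteq> V"
    using keys_add[of m n] assms * by (fastforce simp: mp_over_iff)
qed

lemma mp_eval_in_gen_subring:
  assumes "p \<in> mp_over R V"
  shows "mp_eval x p \<in> gen_subring (R \<union> x ` V)"
  unfolding mp_eval_def
proof (intro is_subring_sum is_subring_mult is_subring_prod is_subring_power gen_subring_is_subring)
  show "Poly_Mapping.lookup p m \<in> gen_subring (R \<union> x ` V)" for m
    using assms gen_subring_incl[of "R \<union> x ` V"] by (auto simp: mp_over_iff)
  show "x v \<in> gen_subring (R \<union> x ` V)" if "m \<in> Poly_Mapping.keys p" "v \<in> Poly_Mapping.keys m" for m v
  proof -
    have "v \<in> V" using assms that by (auto simp: mp_over_iff)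
    then show ?thesis using gen_subring_incl[of "R \<union> x ` V"] by auto
  qed
qed

text \<open>The polynomial values form a ring that contains the generators. This supplies an actual
  polynomial for each element of a generated ring.\<close>

lemma gen_subring_eq_mp_eval: "gen_subring (R \<union> x ` V) = mp_eval x ` mp_over R V"
proof
  have "is_subring (mp_eval x ` mp_over R V)"
    unfolding is_subring_def
  proof (intro conjI ballI)
    show "1 \<in> mp_eval x ` mp_over R V"
      using is_subring_one[OF R]
      by (intro image_eqI[of _ _ "Poly_Mapping.single 0 1"] mp_over_single) (auto simp del: single_one)
  next
    fix a b assume "a \<in> mp_eval x ` mp_over R V" "b \<in> mp_eval x ` mp_over R V"
    then obtain p q where pq: "p \<in> mp_over R V" "q \<in> mp_over R V" "a = mp_eval x p" "b = mp_eval x q"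
      by blast
    show "a - b \<in> mp_eval x ` mp_over R V"
      using pq mp_over_add[OF pq(1) mp_over_uminus[OF pq(2)]]
      by (intro image_eqI[of _ _ "p - q"]) (auto simp: mp_eval_diff)
    show "a * b \<in> mp_eval x ` mp_over R V"
      using pq by (intro image_eqI[of _ _ "p * q"] mp_over_mult) (auto simp: mp_eval_mult)
  qed
  moreover have "R \<subseteq> mp_eval x ` mp_over R V"
  proof
    fix a assume "a \<in> R"
    then show "a \<in> mp_eval x ` mp_over R V"
      by (intro image_eqI[of _ _ "Poly_Mapping.single 0 a"] mp_over_single) auto
  qed
  moreover have "x ` V \<subseteq> mp_eval x ` mp_over R V"
  proof
    fix a assume "a \<in> x ` V"
    then obtain v where "v \<in> V" "a = x v" by blast
    then show "a \<in> mp_eval x ` mp_over R V"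
      using is_subring_one[OF R]
      by (intro image_eqI[of _ _ "Poly_Mapping.single (Poly_Mapping.single v 1) 1"] mp_over_single) auto
  qed
  ultimately show "gen_subring (R \<union> x ` V) \<subseteq> mp_eval x ` mp_over R V"
    by (intro gen_subring_least) auto
  show "mp_eval x ` mp_over R V \<subseteq> gen_subring (R \<union> x ` V)"
    using mp_eval_in_gen_subring by blast
qed

end

section \<open>Values of partial derivatives\<close>

lemma mp_eval_pderiv_superset:
  assumes "finite A" "Poly_Mapping.keys p \<subseteq> A"
  shows "mp_eval x (mp_pderiv v p) =
    (\<Sum>m\<in>A. of_nat (Poly_Mapping.lookup m v) * Poly_Mapping.lookup p m * mon x (m - Poly_Mapping.single v 1))"
  unfolding mp_pderiv_def mp_eval_sum mp_eval_single
  using assms by (intro sum.mono_neutral_left) (auto simp: in_keys_iff)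

lemma mp_eval_pderiv_0 [simp]: "mp_eval x (mp_pderiv v 0) = 0"
  by (simp add: mp_pderiv_def)

lemma mp_eval_pderiv_single [simp]:
  "mp_eval x (mp_pderiv v (Poly_Mapping.single m c)) =
     of_nat (Poly_Mapping.lookup m v) * c * mon x (m - Poly_Mapping.single v 1)"
  by (subst mp_eval_pderiv_superset[of "{m}"]) auto

lemma mp_eval_pderiv_add:
  "mp_eval x (mp_pderiv v (p + q)) = mp_eval x (mp_pderiv v p) + mp_eval x (mp_pderiv v q)"
proof -
  define A where "A = Poly_Mapping.keys p \<union> Poly_Mapping.keys q"
  have "finite A" "Poly_Mapping.keys p \<subseteq> A" "Poly_Mapping.keys q \<subseteq> A"
    "Poly_Mapping.keys (p + q) \<subseteq> A"
    using keys_add[of p q] by (auto simp: A_def)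
  then show ?thesis
    by (simp add: mp_eval_pderiv_superset[of A] lookup_add sum.distrib algebra_simps)
qed

lemma mp_eval_pderiv_sum:
  "mp_eval x (mp_pderiv v (sum p I)) = (\<Sum>i\<in>I. mp_eval x (mp_pderiv v (p i)))"
  by (induction I rule: infinite_finite_induct) (simp_all add: mp_eval_pderiv_add)

lemma mp_eval_pderiv_notin_vars:
  assumes "v \<notin> mp_vars p"
  shows "mp_eval x (mp_pderiv v p) = 0"
  unfolding mp_eval_pderiv_superset[OF finite_keys order_refl]
  using assms by (intro sum.neutral) (auto simp: mp_vars_def in_keys_iff)

text \<open>Injectivity of \<open>g\<close> keeps the monomials apart, so the coefficient at
  \<open>g i\<close> is \<open>d i\<close> and nothing cancels.\<close>

lemma sum_single_neq_0:
  assumes "finite I" "inj_on g I" "i \<in> I" "d i \<noteq> 0"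
  shows "(\<Sum>i\<in>I. Poly_Mapping.single (g i) (d i)) \<noteq> 0"
proof
  assume "(\<Sum>i\<in>I. Poly_Mapping.single (g i) (d i)) = 0"
  then have "0 = (\<Sum>j\<in>I. Poly_Mapping.lookup (Poly_Mapping.single (g j) (d j)) (g i))"
    by (metis lookup_sum lookup_zero)
  also have "\<dots> = (\<Sum>j\<in>I. if j = i then d j else 0)"
    using assms(2,3) by (intro sum.cong) (auto simp: lookup_single when_def inj_on_def)
  also have "\<dots> = d i"
    using assms(1,3) by simp
  finally show False using assms(4) by simp
qed

text \<open>Each coefficient of \<open>q\<close> is the value of a polynomial \<open>P k\<close> in
  the variables \<open>V\<close>; multiplying it by the \<open>k\<close>-th power of the variable
  \<open>i\<close> and summing gives \<open>f\<close>. As \<open>i\<close> is not in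
  \<open>V\<close>, the derivative by \<open>i\<close> acts on these powers only, and terms from
  different \<open>k\<close> cannot cancel.\<close>

lemma multipoly_of_poly:
  fixes x :: "'v \<Rightarrow> 'a::field"
  assumes R: "is_subring R" and q: "\<And>k. coeff q k \<in> gen_subring (R \<union> x ` V)" and i: "i \<notin> V"
  obtains f where "f \<in> mp_over R (insert i V)" "mp_eval x f = poly q (x i)"
    "mp_eval x (mp_pderiv i f) = poly (pderiv q) (x i)" "q \<noteq> 0 \<Longrightarrow> f \<noteq> 0"
proof -
  have "\<exists>P. P \<in> mp_over R V \<and> mp_eval x P = coeff q k" for k
    using q[of k] gen_subring_eq_mp_eval[OF R, of x V] by (auto simp: image_iff)
  then obtain P where P: "\<And>k. P k \<in> mp_over R V" "\<And>k. mp_eval x (P k) = coeff q k"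
    by metis
  define I where "I = Sigma {..degree q} (\<lambda>k. Poly_Mapping.keys (P k))"
  define g where "g = (\<lambda>(k :: nat, m :: 'v \<Rightarrow>\<^sub>0 nat). m + Poly_Mapping.single i k)"
  define c where "c = (\<lambda>(k, m). Poly_Mapping.lookup (P k) m)"
  define f :: "('v, 'a) multipoly" where "f = (\<Sum>j\<in>I. Poly_Mapping.single (g j) (c j))"
  have fin: "finite I" by (simp add: I_def)
  have m_i: "Poly_Mapping.lookup m i = 0" "Poly_Mapping.keys m \<subseteq> V" if "(k, m) \<in> I" for k m
    using that P(1)[of k] i by (auto simp: I_def mp_over_iff in_keys_iff subset_iff)
  have keys_single_subset: "Poly_Mapping.keys (Poly_Mapping.single i k) \<subseteq> {i}" for k :: nat
    by simp
  have f_over: "f \<in> mp_over R (insert i V)"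
    unfolding f_def
  proof (intro mp_over_sum[OF R] mp_over_single[OF R])
    fix j assume "j \<in> I"
    then obtain k m where j: "j = (k, m)" "(k, m) \<in> I" by (cases j) auto
    show "c j \<in> R" using P(1)[of k] by (auto simp: c_def j mp_over_iff)
    show "Poly_Mapping.keys (g j) \<subseteq> insert i V"
      using m_i[OF j(2)] keys_add[of m "Poly_Mapping.single i k"] keys_single_subset[of k]
      by (auto simp: g_def j)
  qed
  have Pk: "(\<Sum>m\<in>Poly_Mapping.keys (P k). Poly_Mapping.lookup (P k) m * mon x m) = coeff q k" for k
    by (simp flip: P(2) add: mp_eval_superset[OF finite_keys order_refl])
  have "mp_eval x f = (\<Sum>(k, m)\<in>I. Poly_Mapping.lookup (P k) m * mon x m * x i ^ k)"
    by (simp add: f_def mp_eval_sum case_prod_unfold g_def c_def mon_add algebra_simps)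
  also have "\<dots> = (\<Sum>k\<le>degree q. coeff q k * x i ^ k)"
    by (simp add: I_def sum.Sigma[symmetric] sum_distrib_right[symmetric] Pk)
  finally have eval_f: "mp_eval x f = poly q (x i)"
    by (simp add: poly_altdef)
  have "mp_eval x (mp_pderiv i f) =
      (\<Sum>(k, m)\<in>I. Poly_Mapping.lookup (P k) m * mon x m * (of_nat k * x i ^ (k - 1)))"
    unfolding f_def mp_eval_pderiv_sum
  proof (intro sum.cong refl)
    fix j assume "j \<in> I"
    then obtain k m where j: "j = (k, m)" "(k, m) \<in> I" by (cases j) auto
    \<comment> \<open>For \<open>k = 0\<close> the exponent subtraction truncates, but there the
      factor \<open>of_nat k\<close> vanishes.\<close>
    have "m + Poly_Mapping.single i k - Poly_Mapping.single i 1 = m + Poly_Mapping.single i (k - 1)"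
      if "k > 0"
      by (rule poly_mapping_eqI)
        (use that m_i[OF j(2)] in \<open>auto simp: lookup_add lookup_minus lookup_single when_def\<close>)
    then show "mp_eval x (mp_pderiv i (Poly_Mapping.single (g j) (c j))) =
        (case j of (k, m) \<Rightarrow> Poly_Mapping.lookup (P k) m * mon x m * (of_nat k * x i ^ (k - 1)))"
      using m_i[OF j(2)] by (cases "k = 0") (auto simp: j g_def c_def lookup_add mon_add)
  qed
  also have "\<dots> = (\<Sum>k\<le>degree q. coeff q k * (of_nat k * x i ^ (k - 1)))"
    by (simp add: I_def sum.Sigma[symmetric] sum_distrib_right[symmetric] Pk)
  also have "\<dots> = poly (pderiv q) (x i)"
  proof -
    have "pderiv q = (\<Sum>k\<le>degree q. monom (coeff q k * of_nat k) (k - 1))"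
      by (subst poly_as_sum_of_monoms[symmetric, of q])
        (simp add: pderiv_sum pderiv_monom mult.commute del: poly_as_sum_of_monoms)
    then show ?thesis
      by (simp add: poly_sum poly_monom mult.assoc)
  qed
  finally have deriv_f: "mp_eval x (mp_pderiv i f) = poly (pderiv q) (x i)" .
  have "f \<noteq> 0" if "q \<noteq> 0"
  proof -
    \<comment> \<open>The leading coefficient is nonzero, so \<open>P k\<close> has a monomial, and
      it survives in \<open>f\<close>.\<close>
    define k where "k = degree q"
    have "mp_eval x (P k) \<noteq> 0" using that by (simp add: P k_def)
    then have "P k \<noteq> 0" by auto
    then obtain m where m: "m \<in> Poly_Mapping.keys (P k)" by fastforce
    have "inj_on g I"
    proof (rule inj_onI)
      fix a b assume *: "a \<in> I" "b \<in> I" "g a = g b"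
      obtain k m k' m' where ab: "a = (k, m)" "b = (k', m')" by (cases a, cases b) auto
      have eq: "m + Poly_Mapping.single i k = m' + Poly_Mapping.single i k'"
        using * by (simp add: ab g_def)
      then have "Poly_Mapping.lookup (m + Poly_Mapping.single i k) i =
          Poly_Mapping.lookup (m' + Poly_Mapping.single i k') i" by simp
      then have "k = k'" using m_i[of k m] m_i[of k' m'] * by (simp add: ab lookup_add)
      then show "a = b" using eq by (simp add: ab)
    qed
    then show ?thesis
      unfolding f_def using m by (intro sum_single_neq_0[OF fin, of _ "(k, m)"])
        (auto simp: I_def k_def c_def in_keys_iff)
  qed
  then show ?thesis
    using that f_over eval_f deriv_f by blast
qed

lemma mon_remove:
  "mon x m = (\<Prod>v\<in>Poly_Mapping.keys m - {i}. x v ^ Poly_Mapping.lookup m v) * x i ^ Poly_Mapping.lookup m i"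
  by (subst mon_superset[of "insert i (Poly_Mapping.keys m)"])
    (auto simp: prod.insert_remove mult.commute)

lemma mon_diff_single:
  assumes "k \<le> Poly_Mapping.lookup m i"
  shows "mon x (m - Poly_Mapping.single i k) =
    (\<Prod>v\<in>Poly_Mapping.keys m - {i}. x v ^ Poly_Mapping.lookup m v) * x i ^ (Poly_Mapping.lookup m i - k)"
proof -
  have "Poly_Mapping.keys (m - Poly_Mapping.single i k) \<subseteq> insert i (Poly_Mapping.keys m)"
    by (auto simp: in_keys_iff lookup_minus)
  then show ?thesis
    by (subst mon_superset[of "insert i (Poly_Mapping.keys m)"])
      (auto simp: prod.insert_remove lookup_minus lookup_single when_def mult.commute[of "x i ^ _"]
        intro!: arg_cong2[where f = "(*)"] prod.cong split: if_splits)
qed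

text \<open>Partial evaluation: only the variable \<open>i\<close> stays an indeterminate. It turns
  a relation between several elements into an equation for one of them.\<close>

definition univariate :: "('v \<Rightarrow> 'a::field) \<Rightarrow> 'v \<Rightarrow> ('v, 'a) multipoly \<Rightarrow> 'a poly" where
  "univariate x i p = (\<Sum>m\<in>Poly_Mapping.keys p.
     monom (Poly_Mapping.lookup p m * (\<Prod>v\<in>Poly_Mapping.keys m - {i}. x v ^ Poly_Mapping.lookup m v))
       (Poly_Mapping.lookup m i))"

lemma poly_univariate: "poly (univariate x i p) (x i) = mp_eval x p"
  by (simp add: univariate_def poly_sum poly_monom mp_eval_superset[OF finite_keys order_refl]
        mon_remove[of x _ i] mult.assoc)

lemma poly_pderiv_univariate: "poly (pderiv (univariate x i p)) (x i) = mp_eval x (mp_pderiv i p)"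
  unfolding mp_eval_pderiv_superset[OF finite_keys order_refl]
  unfolding univariate_def pderiv_sum pderiv_monom poly_sum poly_monom
proof (intro sum.cong refl)
  fix m
  show "of_nat (Poly_Mapping.lookup m i) * (Poly_Mapping.lookup p m *
      (\<Prod>v\<in>Poly_Mapping.keys m - {i}. x v ^ Poly_Mapping.lookup m v)) * x i ^ (Poly_Mapping.lookup m i - 1) =
    of_nat (Poly_Mapping.lookup m i) * Poly_Mapping.lookup p m * mon x (m - Poly_Mapping.single i 1)"
    by (cases "Poly_Mapping.lookup m i = 0") (auto simp: mon_diff_single)
qed

lemma coeff_univariate:
  "coeff (univariate x i p) k = (\<Sum>m\<in>{m \<in> Poly_Mapping.keys p. Poly_Mapping.lookup m i = k}.
     Poly_Mapping.lookup p m * mon x (m - Poly_Mapping.single i k))"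
  by (simp add: univariate_def coeff_sum sum.inter_filter[symmetric] mon_diff_single cong: if_cong)

lemma coeff_univariate_in:
  assumes R: "is_subring R" and p: "p \<in> mp_over R (insert i V)"
  shows "coeff (univariate x i p) k \<in> gen_subring (R \<union> x ` V)"
  unfolding coeff_univariate
proof (intro is_subring_sum is_subring_mult gen_subring_is_subring)
  fix m assume m: "m \<in> {m \<in> Poly_Mapping.keys p. Poly_Mapping.lookup m i = k}"
  have incl: "R \<union> x ` V \<subseteq> gen_subring (R \<union> x ` V)" by (rule gen_subring_incl)
  show "Poly_Mapping.lookup p m \<in> gen_subring (R \<union> x ` V)"
    using p incl by (auto simp: mp_over_iff)
  show "mon x (m - Poly_Mapping.single i k) \<in> gen_subring (R \<union> x ` V)"
    unfolding mon_def
  proof (intro is_subring_prod is_subring_power gen_subring_is_subring)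
    fix v assume "v \<in> Poly_Mapping.keys (m - Poly_Mapping.single i k)"
    then have "v \<in> Poly_Mapping.keys m" "v \<noteq> i"
      using m by (auto simp: in_keys_iff lookup_minus lookup_single when_def split: if_splits)
    then have "v \<in> V" using p m by (auto simp: mp_over_iff)
    then show "x v \<in> gen_subring (R \<union> x ` V)" using incl by auto
  qed
qed

section \<open>Algebraic independence\<close>

lemma alg_independent_mono: "alg_independent K T \<Longrightarrow> T' \<subseteq> T \<Longrightarrow> alg_independent K T'"
  by (auto simp: alg_independent_def intro: mp_over_mono)

text \<open>Read as a polynomial in \<open>x\<close> over \<open>K(T)\<close>, a relation must
  vanish identically because \<open>x\<close> is not algebraic. Its coefficients are values at
  \<open>T\<close> of polynomials over \<open>K\<close>, one of them nonzero, which contradicts the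
  independence of \<open>T\<close>.\<close>

lemma alg_independent_insertI:
  fixes K :: "'a::field set"
  assumes K: "is_subfield K" and T: "alg_independent K T" 
    and x: "\<not> algebraic_over (gen_subfield (K \<union> T)) x"
  shows "alg_independent K (insert x T)"
  unfolding alg_independent_def
proof (intro ballI impI, rule ccontr)
  fix p assume p: "p \<in> mp_over K (insert x T)" "mp_eval (\<lambda>t. t) p = 0" "p \<noteq> 0"
  note R = is_subfield_subring[OF K]
  define q where "q = univariate (\<lambda>t. t) x p"
  have "coeff q k \<in> gen_subfield (K \<union> T)" for k
    using coeff_univariate_in[OF R p(1), of "\<lambda>t. t" k] gen_subring_subset_gen_subfield by (auto simp: q_def)
  moreover have "poly q x = 0"
    using poly_univariate[of "\<lambda>t. t" x p] p(2) by (simp add: q_def)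
  ultimately have "q = 0" using x by (auto simp: algebraic_over_def)
  \<comment> \<open>\<open>k\<close> is an exponent of \<open>x\<close> that occurs in
    \<open>p\<close>. The part \<open>r\<close> of \<open>p\<close> with this exponent, stripped of
    \<open>x\<close>, is nonzero, and its value is a coefficient of \<open>q\<close>, hence
    zero.\<close>
  obtain m0 where m0: "m0 \<in> Poly_Mapping.keys p" using p(3) by fastforce
  define k where "k = Poly_Mapping.lookup m0 x"
  define M where "M = {m \<in> Poly_Mapping.keys p. Poly_Mapping.lookup m x = k}"
  define r where "r = (\<Sum>m\<in>M. Poly_Mapping.single (m - Poly_Mapping.single x k) (Poly_Mapping.lookup p m))"
  have "mp_eval (\<lambda>t. t) r = coeff q k"
    by (simp add: r_def q_def coeff_univariate M_def mp_eval_sum)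
  moreover have "r \<in> mp_over K T"
    unfolding r_def
  proof (intro mp_over_sum[OF R] mp_over_single[OF R])
    fix m assume m: "m \<in> M"
    show "Poly_Mapping.lookup p m \<in> K" using p(1) by (auto simp: mp_over_iff)
    show "Poly_Mapping.keys (m - Poly_Mapping.single x k) \<subseteq> T"
    proof
      fix v assume "v \<in> Poly_Mapping.keys (m - Poly_Mapping.single x k)"
      then have "v \<in> Poly_Mapping.keys m" "v \<noteq> x"
        using m by (auto simp: M_def in_keys_iff lookup_minus lookup_single when_def split: if_splits)
      then show "v \<in> T" using p(1) m by (auto simp: mp_over_iff M_def)
    qed
  qed
  ultimately have "r = 0" using T \<open>q = 0\<close> by (simp add: alg_independent_def)
  moreover have "r \<noteq> 0"
    unfolding r_def
  proof (rule sum_single_neq_0[of _ _ m0])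
    show "finite M" by (simp add: M_def)
    show "inj_on (\<lambda>m. m - Poly_Mapping.single x k) M"
      by (rule inj_on_inverseI[where g = "\<lambda>m. m + Poly_Mapping.single x k"])
        (simp add: M_def single_add_diff)
  qed (use m0 in \<open>auto simp: M_def k_def in_keys_iff\<close>)
  ultimately show False by simp
qed

text \<open>The product of one denominator for each coefficient up to the degree works.\<close>

lemma clear_denominators:
  fixes p :: "'a::field poly"
  assumes "\<And>i. coeff p i \<in> gen_subfield S"
  obtains c where "c \<noteq> 0" "c \<in> gen_subring S" "\<And>i. c * coeff p i \<in> gen_subring S"
proof -
  note R = gen_subring_is_subring[of S]
  have "\<exists>b. b \<noteq> 0 \<and> b \<in> gen_subring S \<and> b * coeff p i \<in> gen_subring S" for i
    using assms[of i] unfolding gen_subfield_eq_fractions by force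
  then obtain b where b: "\<And>i. b i \<noteq> 0" "\<And>i. b i \<in> gen_subring S"
    "\<And>i. b i * coeff p i \<in> gen_subring S" by metis
  define c where "c = (\<Prod>i\<le>degree p. b i)"
  have "c * coeff p i \<in> gen_subring S" for i
  proof (cases "i \<le> degree p")
    case True
    then have "c * coeff p i = (\<Prod>j\<in>{..degree p} - {i}. b j) * (b i * coeff p i)"
      by (simp add: c_def prod.remove[of _ i] ac_simps)
    then show ?thesis
      using b is_subring_mult[OF R is_subring_prod[OF R, of _ b]] by metis
  qed (auto simp: coeff_eq_0 intro: is_subring_zero[OF R])
  moreover have "c \<noteq> 0" "c \<in> gen_subring S"
    using b by (auto simp: c_def intro: is_subring_prod[OF R])
  ultimately show ?thesis using that by blast
qed

text \<open>Cleared of denominators, an equation over \<open>K(T)\<close> becomes a relation over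
  \<open>K\<close>. It is nontrivial because \<open>x\<close> is not in \<open>T\<close> and so
  serves as a new variable.\<close>

lemma algebraic_imp_not_alg_independent_insert:
  fixes K :: "'a::field set"
  assumes K: "is_subfield K" and "x \<notin> T" and x: "algebraic_over (gen_subfield (K \<union> T)) x"
  shows "\<not> alg_independent K (insert x T)"
proof -
  obtain q where q: "q \<noteq> 0" "\<And>i. coeff q i \<in> gen_subfield (K \<union> T)" "poly q x = 0"
    using x by (auto simp: algebraic_over_def)
  obtain c where c: "c \<noteq> 0" "\<And>i. c * coeff q i \<in> gen_subring (K \<union> T)"
    using clear_denominators[OF q(2)] by metis
  have "coeff (smult c q) k \<in> gen_subring (K \<union> (\<lambda>t. t) ` T)" for k
    using c(2) by simp
  then obtain f where "f \<in> mp_over K (insert x T)" "mp_eval (\<lambda>t. t) f = poly (smult c q) x"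
    "smult c q \<noteq> 0 \<Longrightarrow> f \<noteq> 0"
    using multipoly_of_poly[OF is_subfield_subring[OF K] _ assms(2), of "smult c q" "\<lambda>t. t"] by metis
  then show ?thesis
    using q c(1) by (auto simp: alg_independent_def)
qed

section \<open>The valuation of a discrete place\<close>

lemma placeD:
  assumes "place P"
  shows place_1: "P 1 = Some 1" and place_0: "P 0 = Some 0"
    and place_diff: "\<And>a b c d. P a = Some c \<Longrightarrow> P b = Some d \<Longrightarrow> P (a - b) = Some (c - d)"
    and place_mult: "\<And>a b c d. P a = Some c \<Longrightarrow> P b = Some d \<Longrightarrow> P (a * b) = Some (c * d)"
    and place_None: "\<And>a. P a = None \<Longrightarrow> P (inverse a) = Some 0"
proof -
  show *: "P 1 = Some 1" "\<And>a b c d. P a = Some c \<Longrightarrow> P b = Some d \<Longrightarrow> P (a - b) = Some (c - d)"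
    "\<And>a b c d. P a = Some c \<Longrightarrow> P b = Some d \<Longrightarrow> P (a * b) = Some (c * d)"
    "\<And>a. P a = None \<Longrightarrow> P (inverse a) = Some 0"
    using assms by (auto simp: place_def)
  show "P 0 = Some 0" using *(2)[OF *(1) *(1)] by simp
qed

lemma place_inverse:
  assumes P: "place P" and a: "P a = Some c" "c \<noteq> 0"
  shows "P (inverse a) = Some (inverse c)"
proof (cases "P (inverse a)")
  case None
  then show ?thesis using place_None[OF P None] a by simp
next
  case (Some d)
  have "a \<noteq> 0" using a place_0[OF P] by auto
  then have "P (a * inverse a) = Some 1" using place_1[OF P] by simp
  then have "c * d = 1" using place_mult[OF P a(1) Some] by simp
  then show ?thesis using Some by (simp add: inverse_unique)
qed

lemma val_ring_units_iff:
  assumes P: "place P"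
  shows "a \<in> val_ring_units P \<longleftrightarrow> (\<exists>c. c \<noteq> 0 \<and> P a = Some c)"
proof
  assume a: "a \<in> val_ring_units P"
  then obtain c d where cd: "P a = Some c" "P (inverse a) = Some d" "a \<noteq> 0"
    by (auto simp: val_ring_units_def val_ring_def)
  then show "\<exists>c. c \<noteq> 0 \<and> P a = Some c"
    using place_mult[OF P cd(1,2)] place_1[OF P] by auto
next
  assume "\<exists>c. c \<noteq> 0 \<and> P a = Some c"
  then show "a \<in> val_ring_units P"
    using place_inverse[OF P] place_0[OF P] by (auto simp: val_ring_units_def val_ring_def)
qed

lemma val_ring_is_subring:
  assumes P: "place P"
  shows "is_subring (val_ring P)"
  using place_1[OF P] place_diff[OF P] place_mult[OF P] by (fastforce simp: is_subring_def val_ring_def)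

lemma comm_group_mult_group_of_field: "comm_group (mult_group_of_field :: 'a::field monoid)"
proof (rule comm_groupI)
  fix x :: 'a assume "x \<in> carrier mult_group_of_field"
  then show "\<exists>y\<in>carrier mult_group_of_field. y \<otimes>\<^bsub>mult_group_of_field\<^esub> x = \<one>\<^bsub>mult_group_of_field\<^esub>"
    by (intro bexI[of _ "inverse x"]) (auto simp: mult_group_of_field_def)
qed (auto simp: mult_group_of_field_def)

text \<open>The isomorphism, composed with the projection to the value group, is a homomorphism
  \<open>w\<close> whose kernel is the unit group. After a correction of sign, an element of
  nonnegative value is a unit times a power of \<open>t\<close> and lies in the ring; an element of
  the ring with negative value would be a unit and have value zero.\<close>

lemma discrete_place_valuation:
  fixes P :: "'a::field \<Rightarrow> 'b::field option"
  assumes P: "place P" and "discrete_place P"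
  obtains v :: "'a \<Rightarrow> int" and t where "t \<noteq> 0" "v t = 1"
    "\<And>a b. a \<noteq> 0 \<Longrightarrow> b \<noteq> 0 \<Longrightarrow> v (a * b) = v a + v b"
    "\<And>a. a \<noteq> 0 \<Longrightarrow> a \<in> val_ring P \<longleftrightarrow> 0 \<le> v a"
proof -
  let ?G = "mult_group_of_field :: 'a monoid"
  let ?U = "val_ring_units P"
  interpret G: comm_group ?G by (rule comm_group_mult_group_of_field)
  have one_P: "1 \<in> val_ring P" using place_1[OF P] by (simp add: val_ring_def)
  note R = val_ring_is_subring[OF P]
  have inv_G: "inv\<^bsub>?G\<^esub> a = inverse a" if "a \<noteq> 0" for a
    using that by (intro G.inv_equality) (auto simp: mult_group_of_field_def)
  have "subgroup ?U ?G"
  proof (rule G.subgroupI)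
    fix a assume "a \<in> ?U"
    then show "inv\<^bsub>?G\<^esub> a \<in> ?U" by (auto simp: inv_G val_ring_units_def)
  qed (auto simp: val_ring_units_def one_P mult_group_of_field_def intro!: exI[of _ 1] is_subring_mult[OF R])
  then have normal: "?U \<lhd> ?G"
    by (simp add: G.normal_iff_subgroup)
  then interpret N: normal ?U ?G .
  obtain \<phi> where \<phi>: "\<phi> \<in> iso (value_group P) integer_group"
    using assms(2) by (auto simp: discrete_place_def is_iso_def)
  have group_Q: "group (?G Mod ?U)" by (rule N.factorgroup_is_group)
  interpret \<phi>: group_hom "?G Mod ?U" integer_group \<phi>
    using \<phi> group_Q by (auto simp: group_hom_def group_hom_axioms_def iso_def value_group_def)
  define w where "w = (\<lambda>a. \<phi> (?U #>\<^bsub>?G\<^esub> a))"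
  have w_hom: "w \<in> hom ?G integer_group"
    unfolding w_def using hom_compose[OF N.r_coset_hom_Mod \<phi>.homh] by (simp add: comp_def)
  have w_mult: "w (a * b) = w a + w b" if "a \<noteq> 0" "b \<noteq> 0" for a b
    using hom_mult[OF w_hom, of a b] that by (simp add: mult_group_of_field_def)
  have coset_in: "?U #>\<^bsub>?G\<^esub> a \<in> carrier (?G Mod ?U)" if "a \<noteq> 0" for a
    using that by (auto simp: FactGroup_def RCOSETS_def mult_group_of_field_def)
  have \<phi>_one: "\<phi> \<one>\<^bsub>?G Mod ?U\<^esub> = 0"
    using \<phi>.hom_one by (simp add: integer_group_def)
  have inj_\<phi>: "inj_on \<phi> (carrier (?G Mod ?U))"
    using \<phi> by (simp add: iso_def bij_betw_def value_group_def)
  have w_0_iff: "w a = 0 \<longleftrightarrow> a \<in> ?U" if "a \<noteq> 0" for a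
  proof
    assume "w a = 0"
    then have "\<phi> (?U #>\<^bsub>?G\<^esub> a) = \<phi> \<one>\<^bsub>?G Mod ?U\<^esub>"
      using \<phi>_one by (simp add: w_def)
    then have "?U #>\<^bsub>?G\<^esub> a = \<one>\<^bsub>?G Mod ?U\<^esub>"
      by (rule inj_onD[OF inj_\<phi>]) (intro coset_in[OF that] monoid.one_closed group.is_monoid[OF group_Q])+
    then show "a \<in> ?U"
      using G.coset_join1[OF _ _ N.subgroup_axioms, of a] that
      by (auto simp: FactGroup_def mult_group_of_field_def)
  next
    assume "a \<in> ?U"
    then have "?U #>\<^bsub>?G\<^esub> a = \<one>\<^bsub>?G Mod ?U\<^esub>"
      using G.coset_join2[OF _ N.subgroup_axioms, of a] that
      by (auto simp: FactGroup_def mult_group_of_field_def)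
    then show "w a = 0" using \<phi>_one by (simp add: w_def)
  qed
  have "\<phi> ` carrier (value_group P) = UNIV"
    using \<phi> by (auto simp: iso_def bij_betw_def)
  then obtain Z where Z: "Z \<in> carrier (value_group P)" "\<phi> Z = 1"
    by (metis imageE UNIV_I)
  then obtain t0 where "t0 \<in> carrier ?G" "Z = ?U #>\<^bsub>?G\<^esub> t0"
    unfolding value_group_def FactGroup_def RCOSETS_def by auto
  then have t0: "t0 \<noteq> 0" "w t0 = 1"
    using Z(2) by (auto simp: w_def mult_group_of_field_def)
  have w_1: "w 1 = 0" using w_mult[of 1 1] by simp
  have w_inverse: "w (inverse a) = - w a" if "a \<noteq> 0" for a
    using w_mult[of a "inverse a"] that w_1 by simp
  \<comment> \<open>The isomorphism need not respect the orderings. So \<open>t\<close> is whichever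
    of \<open>t0\<close> and its inverse lies in the valuation ring, and \<open>s\<close> is the
    sign that gives it value one.\<close>
  obtain t :: 'a and s :: int where t: "t \<noteq> 0" "s * w t = 1" "s * s = 1" "P t \<noteq> None"
  proof (cases "P t0 = None")
    case True
    show ?thesis
      using that[of "inverse t0" "-1"] t0 w_inverse[of t0] place_None[OF P True] by simp
  next
    case False
    show ?thesis using that[of t0 1] t0 False by simp
  qed
  define v where "v = (\<lambda>a. s * w a)"
  have v_mult: "v (a * b) = v a + v b" if "a \<noteq> 0" "b \<noteq> 0" for a b
    using w_mult[OF that] by (simp add: v_def distrib_left)
  have v_0_iff: "v a = 0 \<longleftrightarrow> a \<in> ?U" if "a \<noteq> 0" for a
    using w_0_iff[OF that] t(3) by (auto simp: v_def)
  have v_t: "v t = 1" using t(2) by (simp add: v_def)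
  have v_inverse: "v (inverse a) = - v a" if "a \<noteq> 0" for a
    using w_inverse[OF that] by (simp add: v_def)
  have v_power: "v (t ^ n) = int n" for n
    by (induction n) (use v_mult v_t t(1) w_1 in \<open>auto simp: v_def\<close>)
  have nonneg: "a \<in> val_ring P" if a: "a \<noteq> 0" and "0 \<le> v a" for a
  proof -
    define u where "u = a * inverse (t ^ nat (v a))"
    have "v u = 0" "u \<noteq> 0"
      using a t(1) \<open>0 \<le> v a\<close> v_inverse[of "t ^ nat (v a)"]
      by (simp_all add: u_def v_mult v_power del: inverse_eq_divide)
    then have "u \<in> val_ring P"
      using v_0_iff by (auto simp: val_ring_units_def)
    moreover have "t ^ nat (v a) \<in> val_ring P"
      using t(4) by (intro is_subring_power[OF R]) (simp add: val_ring_def)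
    ultimately have "u * t ^ nat (v a) \<in> val_ring P"
      by (rule is_subring_mult[OF R])
    then show ?thesis using t(1) by (simp add: u_def mult.assoc)
  qed
  have "0 \<le> v a" if a: "a \<noteq> 0" "a \<in> val_ring P" for a
  proof (rule ccontr)
    assume "\<not> 0 \<le> v a"
    then have "inverse a \<in> val_ring P" using nonneg[of "inverse a"] a(1) v_inverse[of a] by simp
    then have "a \<in> ?U" using a by (simp add: val_ring_units_def)
    then show False using v_0_iff[OF a(1)] \<open>\<not> 0 \<le> v a\<close> by simp
  qed
  then show ?thesis
    using that[of t v] t(1) v_t v_mult nonneg by blast
qed

section \<open>Arithmetic of a normalised valuation with residue field \<open>K\<close>\<close>

locale rational_dvr =
  fixes K :: "'a::field set" and P :: "'a \<Rightarrow> 'a option" and v :: "'a \<Rightarrow> int" and t :: 'a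
  assumes K: "is_subfield K" and P: "place P" and P_K: "a \<in> K \<Longrightarrow> P a = Some a"
    and P_in_K: "P a = Some c \<Longrightarrow> c \<in> K"
    and t_nonzero [simp]: "t \<noteq> 0" and v_t [simp]: "v t = 1"
    and v_mult: "a \<noteq> 0 \<Longrightarrow> b \<noteq> 0 \<Longrightarrow> v (a * b) = v a + v b"
    and val_ring_iff_nonneg: "a \<noteq> 0 \<Longrightarrow> a \<in> val_ring P \<longleftrightarrow> 0 \<le> v a"
begin

abbreviation \<O> where "\<O> \<equiv> val_ring P"

lemma \<O>: "is_subring \<O>" by (rule val_ring_is_subring[OF P])

lemma KR: "is_subring K" by (rule is_subfield_subring[OF K])

lemma K_subset_O: "K \<subseteq> \<O>" using P_K by (auto simp: val_ring_def)

lemma v_1 [simp]: "v 1 = 0" using v_mult[of 1 1] by simp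

lemma v_inverse: "a \<noteq> 0 \<Longrightarrow> v (inverse a) = - v a"
  using v_mult[of a "inverse a"] by simp

lemma v_power: "a \<noteq> 0 \<Longrightarrow> v (a ^ n) = int n * v a"
  by (induction n) (auto simp: v_mult algebra_simps)

definition vge :: "int \<Rightarrow> 'a \<Rightarrow> bool" where "vge n a \<longleftrightarrow> a = 0 \<or> n \<le> v a"

lemma vge_0 [simp]: "vge n 0" by (simp add: vge_def)

lemma O_iff: "a \<in> \<O> \<longleftrightarrow> vge 0 a"
  using val_ring_iff_nonneg is_subring_zero[OF \<O>] by (cases "a = 0") (auto simp: vge_def)

lemma vge_mult: "vge m a \<Longrightarrow> vge n b \<Longrightarrow> vge (m + n) (a * b)"
  by (cases "a = 0 \<or> b = 0") (auto simp: vge_def v_mult)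

lemma vge_mono: "vge m a \<Longrightarrow> n \<le> m \<Longrightarrow> vge n a"
  by (auto simp: vge_def)

lemma vge_t_power_mult_iff: "vge (int n + m) (t ^ n * a) \<longleftrightarrow> vge m a"
  by (cases "a = 0") (auto simp: vge_def v_mult v_power)

lemma vge_iff: "vge (int n) a \<longleftrightarrow> (\<exists>b\<in>\<O>. a = t ^ n * b)"
proof
  assume a: "vge (int n) a"
  have eq: "a = t ^ n * (a / t ^ n)" by simp
  have "vge 0 (a / t ^ n)"
    using a vge_t_power_mult_iff[of n 0 "a / t ^ n"] by simp
  then show "\<exists>b\<in>\<O>. a = t ^ n * b" using eq by (intro bexI[of _ "a / t ^ n"]) (simp_all add: O_iff)
next
  assume "\<exists>b\<in>\<O>. a = t ^ n * b"
  then obtain b where "vge 0 b" "a = t ^ n * b" by (auto simp: O_iff)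
  then show "vge (int n) a"
    using vge_t_power_mult_iff[of n 0 b] by simp
qed

text \<open>Multiplication by an element \<open>s\<close> of valuation \<open>- n\<close> carries
  the claim over to \<open>\<O>\<close>, which is closed under addition.\<close>

lemma vge_add: "vge n a \<Longrightarrow> vge n b \<Longrightarrow> vge n (a + b)"
proof -
  assume *: "vge n a" "vge n b"
  define s where "s = (if 0 \<le> n then inverse (t ^ nat n) else t ^ nat (- n))"
  have s: "s \<noteq> 0" "v s = - n" by (auto simp: s_def v_inverse v_power)
  have "vge n x \<longleftrightarrow> s * x \<in> \<O>" for x
    using s by (cases "x = 0") (auto simp: O_iff vge_def v_mult)
  then show "vge n (a + b)"
    using * by (auto simp: distrib_left intro: is_subring_add[OF \<O>])
qed

lemma vge_uminus: "vge n a \<Longrightarrow> vge n (- a)"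
proof -
  have "- 1 \<in> \<O>" by (intro is_subringD[OF \<O>])
  then show "vge n a \<Longrightarrow> vge n (- a)"
    using vge_mult[of 0 "-1" n a] by (simp add: O_iff)
qed

lemma vge_diff: "vge n a \<Longrightarrow> vge n b \<Longrightarrow> vge n (a - b)"
  using vge_add[of n a "- b"] vge_uminus[of n b] by simp

lemma vge_sum: "(\<And>i. i \<in> I \<Longrightarrow> vge n (f i)) \<Longrightarrow> vge n (sum f I)"
  by (induction I rule: infinite_finite_induct) (auto intro: vge_add)

text \<open>Residue zero characterises the non-units of the valuation ring, and the units are the
  elements of valuation zero.\<close>

lemma P_0_iff: "P a = Some 0 \<longleftrightarrow> vge 1 a"
proof (cases "a = 0")
  case False
  have "a \<in> val_ring_units P \<longleftrightarrow> v a = 0"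
    using False val_ring_iff_nonneg[of a] val_ring_iff_nonneg[of "inverse a"] v_inverse[of a]
    by (auto simp: val_ring_units_def)
  then have "v a = 0 \<longleftrightarrow> (\<exists>c. c \<noteq> 0 \<and> P a = Some c)"
    by (simp add: val_ring_units_iff[OF P])
  moreover have "0 \<le> v a \<longleftrightarrow> P a \<noteq> None"
    using val_ring_iff_nonneg[OF False] by (simp add: val_ring_def)
  ultimately show ?thesis
    using False by (cases "P a") (auto simp: vge_def)
qed (simp add: place_0[OF P])

text \<open>Rationality enters here: the residue of \<open>a\<close> is itself an element of
  \<open>K\<close> and can be subtracted from \<open>a\<close>.\<close>

lemma residue_K:
  assumes "a \<in> \<O>"
  obtains c where "c \<in> K" "P a = Some c" "vge 1 (a - c)"
proof -
  obtain c where c: "P a = Some c" using assms by (auto simp: val_ring_def)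
  then have "c \<in> K" by (rule P_in_K)
  moreover have "P (a - c) = Some 0"
    using place_diff[OF P c P_K[OF \<open>c \<in> K\<close>]] by simp
  ultimately show ?thesis using that c by (simp add: P_0_iff)
qed

lemma v_K: "c \<in> K \<Longrightarrow> c \<noteq> 0 \<Longrightarrow> v c = 0"
  using K_subset_O val_ring_iff_nonneg[of c] val_ring_iff_nonneg[of "inverse c"]
    v_inverse[of c] is_subfield_inverse[OF K, of c] by auto

text \<open>If the valuation of the sum were larger than that of \<open>a\<close>, subtracting
  \<open>b\<close> again would raise the valuation of \<open>a\<close>.\<close>

lemma v_add_eq: "a \<noteq> 0 \<Longrightarrow> vge (v a + 1) b \<Longrightarrow> a + b \<noteq> 0 \<and> v (a + b) = v a"
proof -
  assume *: "a \<noteq> 0" "vge (v a + 1) b"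
  have "vge (v a) (a + b)"
    using *(2) by (intro vge_add) (auto simp: vge_def)
  moreover have "\<not> vge (v a + 1) (a + b)"
  proof
    assume "vge (v a + 1) (a + b)"
    then have "vge (v a + 1) (a + b - b)" using *(2) by (rule vge_diff)
    then show False using *(1) by (simp add: vge_def)
  qed
  ultimately show ?thesis by (auto simp: vge_def)
qed

text \<open>The unique term of least valuation dominates all others.\<close>

lemma sum_distinct_valuations_neq_0:
  assumes "finite I" "I \<noteq> {}" "\<And>i. i \<in> I \<Longrightarrow> f i \<noteq> 0" "inj_on (\<lambda>i. v (f i)) I"
  shows "sum f I \<noteq> 0"
proof -
  obtain i where i: "i \<in> I" "\<And>j. j \<in> I \<Longrightarrow> v (f i) \<le> v (f j)"
    using ex_min_if_finite[of "(\<lambda>i. v (f i)) ` I"] assms(1,2) by fastforce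
  have "vge (v (f i) + 1) (f j)" if "j \<in> I - {i}" for j
  proof -
    have "v (f j) \<noteq> v (f i)" using assms(4) i(1) that by (auto simp: inj_on_def)
    then show ?thesis using i(2)[of j] that by (auto simp: vge_def)
  qed
  then have "f i + sum f (I - {i}) \<noteq> 0"
    using v_add_eq[of "f i" "sum f (I - {i})"] assms(3)[OF i(1)] vge_sum[of "I - {i}"] by blast
  then show ?thesis using assms(1) i(1) by (simp add: sum.remove)
qed

section \<open>Polynomials in the uniformizer: truncation and division\<close>

abbreviation Kt where "Kt \<equiv> gen_subring (insert t K)"

lemma Kt: "is_subring Kt" by (rule gen_subring_is_subring)

lemma t_Kt: "t \<in> Kt" and K_Kt: "K \<subseteq> Kt"
  using gen_subring_incl[of "insert t K"] by auto

lemma t_O: "t \<in> \<O>" by (simp add: O_iff vge_def)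

lemma Kt_subset_O: "Kt \<subseteq> \<O>"
  using K_subset_O t_O by (intro gen_subring_least \<O>) auto

text \<open>This is power series expansion in \<open>t\<close>: the residue of the remainder
  \<open>b\<close> is the next coefficient.\<close>

lemma Kt_truncation:
  assumes "a \<in> \<O>"
  shows "\<exists>c\<in>Kt. \<exists>b\<in>\<O>. a = c + t ^ n * b"
proof (induction n)
  case 0
  then show ?case using assms is_subring_zero[OF Kt] by force
next
  case (Suc n)
  then obtain c b where cb: "c \<in> Kt" "b \<in> \<O>" "a = c + t ^ n * b" by blast
  obtain d where d: "d \<in> K" "vge 1 (b - d)" using residue_K[OF cb(2)] by blast
  then obtain b' where b': "b' \<in> \<O>" "b - d = t * b'" using vge_iff[of 1] by auto
  have "a = (c + t ^ n * d) + t ^ Suc n * b'"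
    using cb(3) b'(2) by (simp add: algebra_simps eq_diff_eq)
  moreover have "c + t ^ n * d \<in> Kt"
    using cb(1) d(1) K_Kt t_Kt by (auto intro!: is_subringD[OF Kt] is_subring_power[OF Kt])
  ultimately show ?case using b'(1) by blast
qed

text \<open>The constant term of a polynomial in \<open>t\<close> has valuation zero unless it
  vanishes, so positive valuation lets one factor \<open>t\<close> come off. Divisibility by
  \<open>t ^ n\<close> in \<open>\<O>\<close> thus already holds in \<open>K[t]\<close>.\<close>

lemma Kt_divide_t_power:
  assumes "c \<in> Kt" "vge (int n) c"
  shows "\<exists>d\<in>Kt. c = t ^ n * d"
  using assms
proof (induction n arbitrary: c)
  case (Suc n)
  have "\<exists>c0\<in>K. \<exists>d\<in>Kt. c = c0 + t * d" if "c \<in> Kt" for c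
  proof -
    \<comment> \<open>\<open>Q\<close> is a ring that contains \<open>K\<close> and
      \<open>t\<close>, hence all of \<open>Kt\<close>; this splits off the constant term.\<close>
    define Q where "Q = {c0 + t * d |c0 d. c0 \<in> K \<and> d \<in> Kt}"
    have "is_subring Q"
      unfolding is_subring_def
    proof (intro conjI ballI)
      show "1 \<in> Q"
        using is_subring_one[OF KR] is_subring_zero[OF Kt] unfolding Q_def
        by (intro CollectI exI[of _ 1] exI[of _ 0]) auto
    next
      fix x y assume "x \<in> Q" "y \<in> Q"
      then obtain c d c' d' where *: "c \<in> K" "d \<in> Kt" "c' \<in> K" "d' \<in> Kt" "x = c + t * d" "y = c' + t * d'"
        by (auto simp: Q_def)
      have "x - y = (c - c') + t * (d - d')" "x * y = (c * c') + t * (c * d' + c' * d + t * d * d')"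
        using * by (auto simp: algebra_simps)
      moreover have "c - c' \<in> K" "c * c' \<in> K" "d - d' \<in> Kt" "c * d' + c' * d + t * d * d' \<in> Kt"
        using * K_Kt t_Kt by (auto intro!: is_subringD[OF Kt] intro: is_subringD[OF KR])
      ultimately show "x - y \<in> Q" "x * y \<in> Q"
        unfolding Q_def by blast+
    qed
    moreover have "K \<subseteq> Q"
      using is_subring_zero[OF Kt] unfolding Q_def by force
    moreover have "t \<in> Q"
      using is_subring_zero[OF KR] is_subring_one[OF Kt] unfolding Q_def
      by (intro CollectI exI[of _ 0] exI[of _ 1]) auto
    ultimately have "Kt \<subseteq> Q" by (intro gen_subring_least) auto
    then have "c \<in> Q" using that by blast
    then show ?thesis unfolding Q_def by blast
  qed
  then obtain c0 d where c: "c0 \<in> K" "d \<in> Kt" "c = c0 + t * d" using Suc.prems(1) by blast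
  have "vge 1 (t * d)" using vge_iff[of 1 "t * d"] c(2) Kt_subset_O by auto
  moreover have "vge 1 c" using Suc.prems(2) vge_mono by auto
  ultimately have "vge 1 (c - t * d)" by (intro vge_diff)
  then have "vge 1 c0" using c(3) by simp
  then have "c0 = 0" using v_K[OF c(1)] by (cases "c0 = 0") (auto simp: vge_def)
  then have "vge (int n) d"
    using Suc.prems(2) c(3) vge_t_power_mult_iff[of 1 "int n" d] by simp
  then obtain d' where "d' \<in> Kt" "d = t ^ n * d'" using Suc.IH[OF c(2)] by blast
  then show ?case using c(3) \<open>c0 = 0\<close> by (auto simp: mult.assoc)
qed auto

end

section \<open>Separable generation over a uniformizer\<close>

lemma mult_sum_div_le:
  fixes a :: "'i \<Rightarrow> nat"
  shows "p * (\<Sum>i\<in>I. a i div p) \<le> (\<Sum>i\<in>I. a i)"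
  by (simp add: sum_distrib_left sum_mono)

context rational_dvr
begin

text \<open>Induction on the number of terms, by elimination against a nonzero \<open>u0\<close> of
  least valuation. Since \<open>C\<close> vanishes, the sum is unchanged when \<open>i0\<close> is
  dropped and the other \<open>u i\<close> become \<open>w i\<close>, so the hypothesis on it is
  inherited; a relation between the \<open>w i\<close> unfolds to one between the
  \<open>u i\<close>.\<close>

lemma frobenius_relation:
  assumes p: "prime CHAR('a)"
    and I: "finite I" "I \<noteq> {}" and c: "\<And>i. i \<in> I \<Longrightarrow> c i \<in> K \<and> c i \<noteq> 0"
    and s: "(\<Sum>i\<in>I. c i * u i ^ CHAR('a)) = 0 \<or> \<not> int CHAR('a) dvd v (\<Sum>i\<in>I. c i * u i ^ CHAR('a))"
  shows "\<exists>d. (\<forall>i\<in>I. d i \<in> K) \<and> (\<exists>i\<in>I. d i \<noteq> 0) \<and> (\<Sum>i\<in>I. d i * u i) = 0"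
  using I c s
proof (induction "card I" arbitrary: I u rule: less_induct)
  case less
  let ?p = "CHAR('a)"
  note fin = \<open>finite I\<close> and c = less.prems(3)
  have p0: "?p > 0" using p by (rule prime_gt_0_nat)
  show ?case
  proof (cases "\<forall>i\<in>I. u i = 0")
    case True
    then show ?thesis
      using less.prems(2) is_subring_one[OF KR] by (intro exI[of _ "\<lambda>_. 1"]) auto
  next
    case False
    define I' where "I' = {i \<in> I. u i \<noteq> 0}"
    have "finite I'" "I' \<noteq> {}" using fin False by (auto simp: I'_def)
    then obtain i0 where i0: "i0 \<in> I'" "\<And>j. j \<in> I' \<Longrightarrow> v (u i0) \<le> v (u j)"
      using ex_min_if_finite[of "(\<lambda>i. v (u i)) ` I'"] by fastforce
    define u0 where "u0 = u i0"
    have u0: "u0 \<noteq> 0" "i0 \<in> I" using i0(1) by (auto simp: I'_def u0_def)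
    define J where "J = I - {i0}"
    have "\<exists>l. l \<in> K \<and> vge (v u0 + 1) (u i - l * u0)" if "i \<in> I" for i
    proof -
      have "vge (v u0) (u i)"
        using i0(2)[of i] that by (auto simp: vge_def I'_def u0_def)
      then have "vge (v u0 + - v u0) (u i * inverse u0)"
        using u0 by (intro vge_mult) (auto simp: vge_def v_inverse)
      then have "u i * inverse u0 \<in> \<O>" by (simp add: O_iff)
      then obtain l where l: "l \<in> K" "vge 1 (u i * inverse u0 - l)" using residue_K by blast
      have "vge (1 + v u0) ((u i * inverse u0 - l) * u0)"
        using l(2) by (rule vge_mult) (simp add: vge_def)
      moreover have "(u i * inverse u0 - l) * u0 = u i - l * u0"
        using u0 by (simp add: left_diff_distrib mult.assoc)
      ultimately show ?thesis using l(1) by (auto simp: add.commute)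
    qed
    then obtain l where l: "\<And>i. i \<in> I \<Longrightarrow> l i \<in> K" "\<And>i. i \<in> I \<Longrightarrow> vge (v u0 + 1) (u i - l i * u0)"
      by metis
    \<comment> \<open>Subtracting from each \<open>u i\<close> a multiple of \<open>u0\<close> raises its valuation above that of \<open>u0\<close>, so that
      the coefficient \<open>C\<close> of \<open>u0\<close> to the \<open>p\<close> must vanish.\<close>
    define w where "w = (\<lambda>i. u i - l i * u0)"
    define C where "C = c i0 + (\<Sum>i\<in>J. c i * l i ^ ?p)"
    define s' where "s' = (\<Sum>i\<in>J. c i * w i ^ ?p)"
    have C_K: "C \<in> K"
      using c l(1) u0(2) by (auto simp: C_def J_def intro!: is_subringD[OF KR] is_subring_sum[OF KR] is_subring_power[OF KR])
    \<comment> \<open>Frobenius is additive, so \<open>u i = w i + l i * u0\<close> passes to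
      \<open>p\<close>-th powers.\<close>
    have u_p: "u i ^ ?p = w i ^ ?p + l i ^ ?p * u0 ^ ?p" for i
      using freshmans_dream[of ?p "w i" "l i * u0"] p by (simp add: w_def power_mult_distrib)
    have "(\<Sum>i\<in>I. c i * u i ^ ?p) = c i0 * u0 ^ ?p + (\<Sum>i\<in>J. c i * u i ^ ?p)"
      using fin u0(2) by (simp add: J_def sum.remove u0_def)
    also have "\<dots> = C * u0 ^ ?p + s'"
      by (simp add: u_p C_def s'_def algebra_simps sum.distrib sum_distrib_left)
    finally have sum_eq: "(\<Sum>i\<in>I. c i * u i ^ ?p) = C * u0 ^ ?p + s'" .
    have vge_s': "vge (int ?p * (v u0 + 1)) s'"
      unfolding s'_def
    proof (intro vge_sum)
      fix i assume i: "i \<in> J"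
      then have "vge (int ?p * (v u0 + 1)) (w i ^ ?p)"
        using l(2)[of i] by (cases "w i = 0") (auto simp: vge_def w_def J_def v_power p0 mult_left_mono)
      moreover have "vge 0 (c i)"
        using c[of i] i v_K by (auto simp: J_def vge_def)
      ultimately show "vge (int ?p * (v u0 + 1)) (c i * w i ^ ?p)"
        using vge_mult by fastforce
    qed
    have "C = 0"
    proof (rule ccontr)
      assume "C \<noteq> 0"
      have v_C: "v (C * u0 ^ ?p) = int ?p * v u0"
        using \<open>C \<noteq> 0\<close> C_K u0(1) by (simp add: v_mult v_K v_power)
      have "vge (int ?p * v u0 + 1) s'"
        using vge_s' by (rule vge_mono) (use p0 in \<open>simp add: algebra_simps\<close>)
      then have "C * u0 ^ ?p + s' \<noteq> 0 \<and> v (C * u0 ^ ?p + s') = int ?p * v u0"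
        using v_add_eq[of "C * u0 ^ ?p" s'] v_C \<open>C \<noteq> 0\<close> u0(1) by simp
      then show False using less.prems(4) unfolding sum_eq by simp
    qed
    then have "J \<noteq> {}" using c[OF u0(2)] by (auto simp: C_def)
    moreover have "card J < card I"
      unfolding J_def using fin u0(2) by (rule card_Diff1_less)
    moreover have "finite J" "\<And>i. i \<in> J \<Longrightarrow> c i \<in> K \<and> c i \<noteq> 0"
      using fin c by (auto simp: J_def)
    moreover have "s' = 0 \<or> \<not> int ?p dvd v s'"
      using less.prems(4) \<open>C = 0\<close> unfolding sum_eq by simp
    ultimately obtain d where d: "\<And>i. i \<in> J \<Longrightarrow> d i \<in> K" "\<exists>i\<in>J. d i \<noteq> 0" "(\<Sum>i\<in>J. d i * w i) = 0"
      using less.hyps[of J w] unfolding s'_def by blast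
    \<comment> \<open>Substituting \<open>w i = u i - l i * u0\<close> in the relation collects this
      coefficient at \<open>u0\<close>.\<close>
    define e where "e = d(i0 := - (\<Sum>i\<in>J. d i * l i))"
    have "e i \<in> K" if "i \<in> I" for i
      using d(1) l(1) that by (auto simp: e_def J_def intro!: is_subringD[OF KR] is_subring_sum[OF KR])
    moreover have "\<exists>i\<in>I. e i \<noteq> 0"
      using d(2) by (auto simp: e_def J_def)
    moreover have "(\<Sum>i\<in>I. e i * u i) = 0"
    proof -
      have "(\<Sum>i\<in>I. e i * u i) = e i0 * u0 + (\<Sum>i\<in>J. e i * u i)"
        using fin u0(2) by (simp add: J_def sum.remove u0_def)
      also have "(\<Sum>i\<in>J. e i * u i) = (\<Sum>i\<in>J. d i * w i) + (\<Sum>i\<in>J. d i * l i) * u0"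
        unfolding sum_distrib_right sum.distrib[symmetric]
        by (intro sum.cong) (auto simp: e_def J_def w_def algebra_simps)
      finally show ?thesis by (simp add: e_def d(3))
    qed
    ultimately show ?thesis by blast
  qed
qed

text \<open>Take a relation with the least bound \<open>N\<close> on its degrees. If some
  \<open>x\<close> in \<open>S\<close> has an exponent that is nonzero in the field, the derivative
  by \<open>x\<close> is a combination of distinct monomials of smaller degree and cannot vanish.
  Otherwise all exponents on \<open>S\<close> are multiples of the characteristic, which contradicts
  the relation in characteristic zero and its minimality in positive characteristic.\<close>

lemma exists_separable_element:
  assumes S: "finite S" "t \<notin> S" and dep: "\<not> alg_independent K (insert t S)"
  shows "\<exists>x\<in>S. \<exists>q. (\<forall>k. coeff q k \<in> gen_subring (K \<union> insert t (S - {x}))) \<and>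
    poly q x = 0 \<and> poly (pderiv q) x \<noteq> 0"
proof -
  define V where "V = insert t S"
  define deg :: "('a \<Rightarrow>\<^sub>0 nat) \<Rightarrow> nat" where "deg = (\<lambda>m. \<Sum>v\<in>V. Poly_Mapping.lookup m v)"
  define rel where "rel = (\<lambda>N p. p \<in> mp_over K V \<and> p \<noteq> 0 \<and> mp_eval (\<lambda>t. t) p = 0 \<and>
    (\<forall>m\<in>Poly_Mapping.keys p. deg m \<le> N))"
  have finV: "finite V" using S by (simp add: V_def)
  have deg_pos: "deg m > 0" if "v \<in> Poly_Mapping.keys m" "v \<in> V" for m v
    using that finV by (auto simp: deg_def in_keys_iff sum_pos2 intro!: Nat.gr0I)
  obtain p0 where p0: "p0 \<in> mp_over K V" "p0 \<noteq> 0" "mp_eval (\<lambda>t. t) p0 = 0"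
    using dep by (auto simp: alg_independent_def V_def)
  have "rel (Max (deg ` Poly_Mapping.keys p0)) p0"
    using p0 by (auto simp: rel_def)
  then have "\<exists>N p. rel N p" by blast
  define N where "N = (LEAST N. \<exists>p. rel N p)"
  have "\<exists>p. rel N p" unfolding N_def by (rule LeastI_ex) fact
  then obtain p where p: "p \<in> mp_over K V" "p \<noteq> 0" "mp_eval (\<lambda>t. t) p = 0"
    "\<And>m. m \<in> Poly_Mapping.keys p \<Longrightarrow> deg m \<le> N" by (auto simp: rel_def)
  \<comment> \<open>Minimality of \<open>N\<close> in the form used below: distinct monomials of
    degree less than \<open>N\<close> are linearly independent over \<open>K\<close>.\<close>
  have minimal: "(\<Sum>i\<in>I. d i * mon (\<lambda>t. t) (g i)) \<noteq> 0"
    if "finite I" "inj_on g I" "\<And>i. i \<in> I \<Longrightarrow> d i \<in> K" and nz: "\<exists>i\<in>I. d i \<noteq> 0"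
      and "\<And>i. i \<in> I \<Longrightarrow> deg (g i) < N" "\<And>i. i \<in> I \<Longrightarrow> Poly_Mapping.keys (g i) \<subseteq> V"
    for I :: "('a \<Rightarrow>\<^sub>0 nat) set" and g d
  proof
    assume sum: "(\<Sum>i\<in>I. d i * mon (\<lambda>t. t) (g i)) = 0"
    define r where "r = (\<Sum>i\<in>I. Poly_Mapping.single (g i) (d i))"
    have "Poly_Mapping.keys r \<subseteq> (\<Union>i\<in>I. Poly_Mapping.keys (Poly_Mapping.single (g i) (d i)))"
      unfolding r_def by (rule keys_sum)
    also have "\<dots> \<subseteq> g ` I" by auto
    finally have keys_r: "Poly_Mapping.keys r \<subseteq> g ` I" .
    obtain i where i: "i \<in> I" "d i \<noteq> 0" using nz by blast
    have "rel (N - 1) r"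
      unfolding rel_def
    proof (intro conjI ballI)
      show "r \<in> mp_over K V"
        unfolding r_def using that by (intro mp_over_sum[OF KR] mp_over_single[OF KR]) auto
      show "r \<noteq> 0"
        unfolding r_def using that(1,2) i by (rule sum_single_neq_0)
      show "mp_eval (\<lambda>t. t) r = 0"
        using sum by (simp add: r_def mp_eval_sum)
      fix m assume "m \<in> Poly_Mapping.keys r"
      then show "deg m \<le> N - 1" using keys_r that(5) by fastforce
    qed
    \<comment> \<open>\<open>N\<close> is positive because of \<open>deg (g i) < N\<close>, so the
      truncated subtraction still gives a contradiction.\<close>
    then have "N \<le> N - 1" unfolding N_def by (intro Least_le) blast
    then show False using that(5)[OF i(1)] by linarith
  qed
  define M where "M = Poly_Mapping.keys p"
  define c where "c = Poly_Mapping.lookup p"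
  have finM: "finite M" by (simp add: M_def)
  have M_ne: "M \<noteq> {}" using p(2) by (simp add: M_def)
  have c: "c m \<in> K" for m using p(1) by (simp add: c_def mp_over_iff)
  have c0: "c m \<noteq> 0" if "m \<in> M" for m using that by (simp add: c_def M_def in_keys_iff)
  have keys_M: "Poly_Mapping.keys m \<subseteq> V" if "m \<in> M" for m
    using p(1) that by (simp add: M_def mp_over_iff)
  have sum_p: "(\<Sum>m\<in>M. c m * mon (\<lambda>t. t) m) = 0"
    using p(3) by (simp add: mp_eval_superset[OF finite_keys order_refl] M_def c_def)
  show ?thesis
  proof (cases "\<exists>x\<in>S. \<exists>m\<in>M. of_nat (Poly_Mapping.lookup m x) \<noteq> (0::'a)")
    case True
    then obtain x m0 where x: "x \<in> S" "m0 \<in> M" "of_nat (Poly_Mapping.lookup m0 x) \<noteq> (0::'a)" by blast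
    have V_eq: "V = insert x (insert t (S - {x}))" using x(1) by (auto simp: V_def)
    define q where "q = univariate (\<lambda>t. t) x p"
    have "coeff q k \<in> gen_subring (K \<union> insert t (S - {x}))" for k
      using coeff_univariate_in[OF KR p(1)[unfolded V_eq], of "\<lambda>t. t" k] by (simp add: q_def)
    moreover have "poly q x = 0"
      using poly_univariate[of "\<lambda>t. t" x p] p(3) by (simp add: q_def)
    moreover have "poly (pderiv q) x \<noteq> 0"
    proof -
      \<comment> \<open>Only these monomials survive the derivation. The variable \<open>x\<close>
        occurs in each of them, so removing it once is injective and lowers the degree.\<close>
      define M' where "M' = {m \<in> M. of_nat (Poly_Mapping.lookup m x) \<noteq> (0::'a)}"
      define e where "e = Poly_Mapping.single x (1::nat)"
      have pos: "Suc 0 \<le> Poly_Mapping.lookup m x" if "m \<in> M'" for m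
        using that by (cases "Poly_Mapping.lookup m x") (auto simp: M'_def)
      have "poly (pderiv q) x = (\<Sum>m\<in>M. of_nat (Poly_Mapping.lookup m x) * c m * mon (\<lambda>t. t) (m - e))"
        using poly_pderiv_univariate[of "\<lambda>t. t" x p]
        by (simp add: q_def mp_eval_pderiv_superset[OF finite_keys order_refl] M_def c_def e_def)
      also have "\<dots> = (\<Sum>m\<in>M'. of_nat (Poly_Mapping.lookup m x) * c m * mon (\<lambda>t. t) (m - e))"
        by (rule sum.mono_neutral_right[OF finM]) (auto simp: M'_def)
      also have "\<dots> \<noteq> 0"
      proof (rule minimal)
        show "inj_on (\<lambda>m. m - e) M'"
          by (rule inj_on_inverseI[where g = "\<lambda>m. m + e"]) (simp add: e_def single_add_diff pos)
        show "\<exists>m\<in>M'. of_nat (Poly_Mapping.lookup m x) * c m \<noteq> 0"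
          using x c0 by (auto simp: M'_def)
        fix m assume m: "m \<in> M'"
        show "of_nat (Poly_Mapping.lookup m x) * c m \<in> K"
          by (intro is_subring_mult[OF KR] is_subring_of_nat[OF KR] c)
        show "Poly_Mapping.keys (m - e) \<subseteq> V"
        proof
          fix v assume "v \<in> Poly_Mapping.keys (m - e)"
          then have "v \<in> Poly_Mapping.keys m" by (auto simp: in_keys_iff lookup_minus)
          then show "v \<in> V" using keys_M m by (auto simp: M'_def)
        qed
        have "deg (m - e) < deg m"
          unfolding deg_def
        proof (rule sum_strict_mono_ex1[OF finV])
          show "\<exists>v\<in>V. Poly_Mapping.lookup (m - e) v < Poly_Mapping.lookup m v"
            using x(1) pos[OF m] by (intro bexI[of _ x]) (auto simp: V_def e_def lookup_minus)
        qed (simp add: lookup_minus)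
        moreover have "deg m \<le> N" using p(4) m by (simp add: M'_def M_def)
        ultimately show "deg (m - e) < N" by simp
      qed (simp add: M'_def finM)
      finally show ?thesis .
    qed
    ultimately show ?thesis using x(1) by blast
  next
    case False
    then have char_dvd: "CHAR('a) dvd Poly_Mapping.lookup m x" if "m \<in> M" "x \<in> S" for m x
      using that by (auto simp: of_nat_eq_0_iff_char_dvd)
    have mon_V: "mon (\<lambda>t. t) m = t ^ Poly_Mapping.lookup m t * (\<Prod>x\<in>S. x ^ Poly_Mapping.lookup m x)"
      if "Poly_Mapping.keys m \<subseteq> V" for m
      using mon_superset[OF finV that, of "\<lambda>t. t"] S by (simp add: V_def)
    have lookup_eq: "m = m'" if "m \<in> M" "m' \<in> M" "\<And>x. x \<in> V \<Longrightarrow> Poly_Mapping.lookup m x = Poly_Mapping.lookup m' x" for m m'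
    proof (rule poly_mapping_eqI)
      fix x show "Poly_Mapping.lookup m x = Poly_Mapping.lookup m' x"
        using keys_M[OF that(1)] keys_M[OF that(2)] that(3) by (metis in_keys_iff subsetD)
    qed
    show ?thesis
    proof (cases "CHAR('a) = 0")
      case True
      then have 0: "Poly_Mapping.lookup m x = 0" if "m \<in> M" "x \<in> S" for m x
        using char_dvd[OF that] by simp
      have mon_t: "mon (\<lambda>t. t) m = t ^ Poly_Mapping.lookup m t" if "m \<in> M" for m
        using mon_V[OF keys_M[OF that]] 0[OF that] by simp
      \<comment> \<open>In characteristic zero the relation involves \<open>t\<close> alone, and its
        terms have distinct valuations.\<close>
      have "(\<Sum>m\<in>M. c m * mon (\<lambda>t. t) m) \<noteq> 0"
      proof (rule sum_distinct_valuations_neq_0[OF finM M_ne])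
        show "inj_on (\<lambda>m. v (c m * mon (\<lambda>t. t) m)) M"
        proof (rule inj_onI)
          fix m m' assume *: "m \<in> M" "m' \<in> M" "v (c m * mon (\<lambda>t. t) m) = v (c m' * mon (\<lambda>t. t) m')"
          then have "Poly_Mapping.lookup m t = Poly_Mapping.lookup m' t"
            by (simp add: mon_t v_mult v_power v_K c c0)
          then show "m = m'" using 0 * by (intro lookup_eq) (auto simp: V_def)
        qed
      qed (simp add: mon_t c0)
      then show ?thesis using sum_p by simp
    next
      case False
      \<comment> \<open>From here on \<open>P\<close> is the characteristic and hides the
        place.\<close>
      define P where "P = CHAR('a)"
      have prime: "prime P" unfolding P_def using False prime_CHAR_semidom[where 'a = 'a] by simp
      have P2: "P \<ge> 2" using prime by (rule prime_ge_2_nat)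
      \<comment> \<open>The exponents on \<open>S\<close> are multiples of \<open>P\<close>, so
        \<open>m\<close> is \<open>t ^ j m\<close> times the \<open>P\<close>-th power of
        \<open>g m\<close>, where \<open>j m\<close> is the remainder of the exponent of
        \<open>t\<close>.\<close>
      define g where "g = (\<lambda>m. Poly_Mapping.map (\<lambda>k. k div P) (m :: 'a \<Rightarrow>\<^sub>0 nat))"
      have lookup_g: "Poly_Mapping.lookup (g m) x = Poly_Mapping.lookup m x div P" for m x
        by (simp add: g_def map.rep_eq when_def)
      define j where "j = (\<lambda>m. Poly_Mapping.lookup m t mod P)"
      have keys_g: "Poly_Mapping.keys (g m) \<subseteq> V" if "m \<in> M" for m
      proof
        fix x assume "x \<in> Poly_Mapping.keys (g m)"
        then have "x \<in> Poly_Mapping.keys m" by (intro in_keys_iff[THEN iffD2] notI) (simp add: in_keys_iff lookup_g)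
        then show "x \<in> V" using keys_M[OF that] by blast
      qed
      have mon_g: "mon (\<lambda>t. t) m = t ^ j m * mon (\<lambda>t. t) (g m) ^ P" if "m \<in> M" for m
      proof -
        have "x ^ Poly_Mapping.lookup m x = (x ^ (Poly_Mapping.lookup m x div P)) ^ P" if "x \<in> S" for x
          using char_dvd[OF \<open>m \<in> M\<close> that] by (simp add: P_def flip: power_mult)
        moreover have "t ^ Poly_Mapping.lookup m t = t ^ j m * (t ^ (Poly_Mapping.lookup m t div P)) ^ P"
          by (simp add: j_def flip: power_mult power_add)
        ultimately show ?thesis
          by (simp add: mon_V keys_M that keys_g lookup_g power_mult_distrib prod_power_distrib)
      qed
      have inj_g: "inj_on g {m \<in> M. j m = a}" for a
      proof (rule inj_onI)
        fix m m' assume *: "m \<in> {m \<in> M. j m = a}" "m' \<in> {m \<in> M. j m = a}" "g m = g m'"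
        have g_eq: "Poly_Mapping.lookup m x div P = Poly_Mapping.lookup m' x div P" for x
          using arg_cong[OF *(3), of "\<lambda>h. Poly_Mapping.lookup h x"] by (simp add: lookup_g)
        have "Poly_Mapping.lookup m x = Poly_Mapping.lookup m' x" if "x \<in> V" for x
        proof (cases "x = t")
          case True
          then show ?thesis
            using * g_eq[of t] by (metis (mono_tags, lifting) div_mod_decomp j_def mem_Collect_eq)
        next
          case False
          then have "x \<in> S" using that by (simp add: V_def)
          then show ?thesis
            using * g_eq[of x] char_dvd[of m x] char_dvd[of m' x] by (auto simp: P_def elim!: dvdE)
        qed
        then show "m = m'" using * lookup_eq by blast
      qed
      \<comment> \<open>In degree zero the relation would be a nonzero constant. Positivity of
        \<open>N\<close> turns \<open>2 * deg (g m) \<le> N\<close> into a strict drop of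
        degree.\<close>
      have N_pos: "N > 0"
      proof (rule ccontr)
        assume "\<not> N > 0"
        then have "Poly_Mapping.keys m = {}" if "m \<in> M" for m
          using p(4)[of m] deg_pos[of _ m] keys_M[OF that] that by (fastforce simp: M_def)
        then have "m = 0" if "m \<in> M" for m using that by simp
        then have "M = {0}" using M_ne by blast
        then show False using sum_p c0[of 0] by simp
      qed
      have deg_g: "deg (g m) < N" if "m \<in> M" for m
      proof -
        have "P * deg (g m) \<le> N"
          using mult_sum_div_le[of P "Poly_Mapping.lookup m" V] p(4)[of m] that
          by (simp add: deg_def lookup_g M_def)
        moreover have "2 * deg (g m) \<le> P * deg (g m)" using P2 by simp
        ultimately show ?thesis using N_pos by linarith
      qed
      define u where "u = (\<lambda>m. mon (\<lambda>t. t) (g m))"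
      define Mj where "Mj = (\<lambda>a. {m \<in> M. j m = a})"
      define s where "s = (\<lambda>a. \<Sum>m\<in>Mj a. c m * u m ^ P)"
      have "(\<Sum>m\<in>M. c m * mon (\<lambda>t. t) m) = (\<Sum>a\<in>j ` M. \<Sum>m\<in>Mj a. c m * mon (\<lambda>t. t) m)"
        unfolding Mj_def using finM by (rule sum.image_gen)
      also have "\<dots> = (\<Sum>a\<in>j ` M. t ^ a * s a)"
        unfolding s_def sum_distrib_left
        by (intro sum.cong refl) (auto simp: Mj_def mon_g u_def)
      finally have sum_s: "(\<Sum>a\<in>j ` M. t ^ a * s a) = 0" using sum_p by simp
      \<comment> \<open>Otherwise the valuations of the terms \<open>t ^ a * s a\<close> would be
        pairwise incongruent modulo \<open>P\<close>, and the terms could not sum to zero.\<close>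
      have "\<exists>a\<in>j ` M. s a = 0 \<or> \<not> int P dvd v (s a)"
      proof (rule ccontr)
        assume "\<not> ?thesis"
        then have *: "s a \<noteq> 0" "int P dvd v (s a)" if "a \<in> j ` M" for a using that by auto
        have "(\<Sum>a\<in>j ` M. t ^ a * s a) \<noteq> 0"
        proof (rule sum_distinct_valuations_neq_0)
          show "inj_on (\<lambda>a. v (t ^ a * s a)) (j ` M)"
          proof (rule inj_onI)
            fix a b assume ab: "a \<in> j ` M" "b \<in> j ` M" "v (t ^ a * s a) = v (t ^ b * s b)"
            have "int a + v (s a) = int b + v (s b)"
              using ab(3) * ab(1,2) by (simp add: v_mult v_power)
            then have "int a mod int P = int b mod int P"
              using *(2)[OF ab(1)] *(2)[OF ab(2)] by (metis dvd_imp_mod_0 mod_add_right_eq add.right_neutral)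
            moreover have "a < P" "b < P" using ab(1,2) P2 by (auto simp: j_def)
            ultimately show "a = b" by simp
          qed
        qed (use finM M_ne * in auto)
        then show False using sum_s by simp
      qed
      then obtain a where a: "a \<in> j ` M" "s a = 0 \<or> \<not> int P dvd v (s a)" by blast
      have "\<exists>d. (\<forall>m\<in>Mj a. d m \<in> K) \<and> (\<exists>m\<in>Mj a. d m \<noteq> 0) \<and> (\<Sum>m\<in>Mj a. d m * u m) = 0"
        using a prime c c0 finM unfolding P_def s_def
        by (intro frobenius_relation[of _ c]) (auto simp: Mj_def)
      then obtain d where d: "\<And>m. m \<in> Mj a \<Longrightarrow> d m \<in> K" "\<exists>m\<in>Mj a. d m \<noteq> 0" "(\<Sum>m\<in>Mj a. d m * u m) = 0"
        by blast
      have "(\<Sum>m\<in>Mj a. d m * mon (\<lambda>t. t) (g m)) \<noteq> 0"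
        using finM inj_g[of a] d(1,2) deg_g keys_g by (intro minimal) (auto simp: Mj_def)
      then show ?thesis using d(3) by (simp add: u_def)
    qed
  qed
qed

text \<open>While \<open>S\<close> is dependent together with \<open>t\<close>, a separable element
  is taken out and placed last: its equation uses the remaining elements, which are exactly those
  before it. The independent rest forms the first \<open>s\<close> entries.\<close>

lemma separating_enumeration:
  assumes "finite S" "t \<notin> S"
  shows "\<exists>xs s. set xs = S \<and> distinct xs \<and> s \<le> length xs \<and> alg_independent K (insert t (set (take s xs))) \<and>
    (\<forall>i\<in>{s..<length xs}. \<exists>q. (\<forall>k. coeff q k \<in> gen_subring (K \<union> insert t (set (take i xs)))) \<and>
       poly q (xs ! i) = 0 \<and> poly (pderiv q) (xs ! i) \<noteq> 0)"
  using assms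
proof (induction "card S" arbitrary: S rule: less_induct)
  case less
  show ?case
  proof (cases "alg_independent K (insert t S)")
    case True
    obtain xs where "set xs = S" "distinct xs" using finite_distinct_list[OF less.prems(1)] by blast
    then show ?thesis using True by (intro exI[of _ xs] exI[of _ "length xs"]) auto
  next
    case False
    then obtain x q where x: "x \<in> S" "\<And>k. coeff q k \<in> gen_subring (K \<union> insert t (S - {x}))"
      "poly q x = 0" "poly (pderiv q) x \<noteq> 0"
      using exists_separable_element[OF less.prems] by blast
    have "card (S - {x}) < card S" using x(1) less.prems(1) by (rule card_Diff1_less[rotated])
    then obtain xs s where xs: "set xs = S - {x}" "distinct xs" "s \<le> length xs"
      "alg_independent K (insert t (set (take s xs)))"
      "\<And>i. i \<in> {s..<length xs} \<Longrightarrow> \<exists>q. (\<forall>k. coeff q k \<in> gen_subring (K \<union> insert t (set (take i xs)))) \<and>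
       poly q (xs ! i) = 0 \<and> poly (pderiv q) (xs ! i) \<noteq> 0"
      using less.hyps[of "S - {x}"] less.prems by auto
    have "\<exists>q. (\<forall>k. coeff q k \<in> gen_subring (K \<union> insert t (set (take i (xs @ [x]))))) \<and>
       poly q ((xs @ [x]) ! i) = 0 \<and> poly (pderiv q) ((xs @ [x]) ! i) \<noteq> 0"
      if "i \<in> {s..<length (xs @ [x])}" for i
    proof (cases "i < length xs")
      case True
      then show ?thesis using xs(5)[of i] that by (auto simp: nth_append)
    next
      case False
      then have "i = length xs" using that by simp
      then show ?thesis using x(2-4) xs(1) by auto
    qed
    then show ?thesis
      using xs(1-4) x(1) by (intro exI[of _ "xs @ [x]"] exI[of _ s]) auto
  qed
qed

end

section \<open>Dilatation\<close>

context rational_dvr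
begin

text \<open>In the application \<open>A\<close> is generated over \<open>K\<close> by
  \<open>t\<close> and the earlier \<open>x j\<close>, and \<open>A'\<close> by \<open>t\<close> and
  the \<open>y j\<close> that replace them.\<close>

lemma dilatation:
  assumes A: "is_subring A" "Kt \<subseteq> A" "A \<subseteq> A'" and A': "is_subring A'" "A' \<subseteq> \<O>"
    and trunc: "\<And>c. c \<in> A \<Longrightarrow> \<exists>d\<in>Kt. \<exists>b\<in>A'. c = d + t ^ k * b"
    and q: "q \<in> polys_over A" "poly q x = 0" "poly (pderiv q) x \<noteq> 0"
    and e: "v (poly (pderiv q) x) = int e" "e < M" "M + e \<le> k"
    and x: "x = a + t ^ M * y" "a \<in> Kt" "y \<in> \<O>"
  shows "\<exists>h\<in>polys_over A'. poly h y = 0 \<and> v (poly (pderiv h) y) = 0 \<and> poly (pderiv h) y \<noteq> 0"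
proof -
  \<comment> \<open>With \<open>q(a + Z) = c\<^sub>0 + c\<^sub>1 Z + Z\<^sup>2 r(Z)\<close> we get
    \<open>q(a + t\<^sup>M Y) = c\<^sub>0 + c\<^sub>1 t\<^sup>M Y + t\<^bsup>2M\<^esup> Y\<^sup>2 r(t\<^sup>M Y)\<close>. Here \<open>v(c\<^sub>1) = e\<close> and \<open>v(c\<^sub>0) \<ge> M + e\<close>, and by
    \<open>trunc\<close> these inequalities are divisibilities in \<open>A'\<close>. So \<open>h(Y) = q(a + t\<^sup>M Y) / t\<^bsup>M+e\<^esup>\<close>
    has coefficients in \<open>A'\<close>.\<close>
  define s where "s = pcompose q [:a, 1:]"
  have "s \<in> polys_over A"
    unfolding s_def using q(1) x(2) A is_subring_one[OF A(1)]
    by (intro polys_over_pcompose) (auto simp: polys_over_pCons polys_over_0)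
  moreover obtain c0 c1 r where s: "s = pCons c0 (pCons c1 r)"
    by (metis pCons_cases)
  ultimately have c: "c0 \<in> A" "c1 \<in> A" and r: "r \<in> polys_over A"
    by (auto simp: polys_over_pCons[OF A(1)])
  define z where "z = t ^ M * y"
  have A_O: "A \<subseteq> \<O>" using A(3) A'(2) by blast
  have tA': "t \<in> A'" using t_Kt A by blast
  have z: "vge (int M) z" "z \<in> \<O>"
    using vge_iff[of M z] x(3) vge_mono[of "int M" z 0] by (auto simp: z_def O_iff)
  have poly_s: "poly s z = 0"
    using q(2) x(1) by (simp add: s_def poly_pcompose z_def)
  have "poly (pderiv s) z = poly (pderiv q) x"
    using x(1) by (simp add: s_def pderiv_pcompose poly_pcompose z_def pderiv_pCons)
  \<comment> \<open>\<open>c1\<close> differs from the derivative at \<open>x\<close> by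
    \<open>z * g\<close>, of valuation at least \<open>M\<close>; as \<open>M\<close> exceeds
    \<open>e\<close>, both have valuation \<open>e\<close>.\<close>
  moreover define g where "g = 2 * poly r z + z * poly (pderiv r) z"
  have "poly (pderiv s) z = c1 + z * g"
    by (simp add: s pderiv_pCons g_def algebra_simps)
  ultimately have c1: "c1 = poly (pderiv q) x + - (z * g)" by (simp add: eq_diff_eq)
  have rO: "r \<in> polys_over \<O>" using polys_over_mono[OF A_O r] .
  have rz: "poly r z \<in> \<O>" "poly (pderiv r) z \<in> \<O>"
    using poly_in_subring[OF \<O> rO z(2)] poly_in_subring[OF \<O> polys_over_pderiv[OF \<O> rO] z(2)] by auto
  have "2 \<in> \<O>" using is_subring_of_nat[OF \<O>, of 2] by simp
  then have "g \<in> \<O>"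
    unfolding g_def using rz z(2) by (intro is_subring_add[OF \<O>] is_subring_mult[OF \<O>])
  then have "vge (int M) (z * g)" using vge_mult[OF z(1), of 0 g] by (simp add: O_iff)
  then have "vge (int M) (- (z * g))" by (rule vge_uminus)
  then have "vge (v (poly (pderiv q) x) + 1) (- (z * g))"
    by (rule vge_mono) (use e(1,2) in simp)
  from v_add_eq[OF q(3) this] have v_c1: "c1 \<noteq> 0" "v c1 = int e"
    unfolding c1[symmetric] e(1) by blast+
  \<comment> \<open>Truncation writes \<open>c\<close> as a polynomial in \<open>t\<close> plus a
    multiple of \<open>t ^ k\<close>. As \<open>n \<le> k\<close>, only the polynomial part has to
    be divided by \<open>t ^ n\<close>, which is possible inside \<open>Kt\<close>.\<close>
  have key: "\<exists>w\<in>A'. c = t ^ n * w" if "c \<in> A" "vge (int n) c" "n \<le> k" for c n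
  proof -
    obtain d b where db: "d \<in> Kt" "b \<in> A'" "c = d + t ^ k * b" using trunc[OF \<open>c \<in> A\<close>] by blast
    have "vge (int k) (t ^ k * b)" using vge_iff[of k] db(2) A'(2) by auto
    then have "vge (int n) (c - t ^ k * b)"
      using that(2,3) by (intro vge_diff) (auto intro: vge_mono)
    then obtain d' where d': "d' \<in> Kt" "d = t ^ n * d'"
      using Kt_divide_t_power[OF db(1), of n] db(3) by auto
    have "t ^ k = t ^ n * t ^ (k - n)" using that(3) by (simp flip: power_add)
    then have "c = t ^ n * (d' + t ^ (k - n) * b)"
      using db(3) d'(2) by (simp add: algebra_simps)
    moreover have "d' \<in> A'" using d'(1) A by blast
    then have "d' + t ^ (k - n) * b \<in> A'"
      using db(2) by (intro is_subring_add[OF A'(1)] is_subring_mult[OF A'(1)] is_subring_power[OF A'(1)] tA')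
    ultimately show ?thesis by blast
  qed
  obtain w where w: "w \<in> A'" "c1 = t ^ e * w"
    using key[OF c(2), of e] v_c1 e(3) by (auto simp: vge_def)
  have c0: "c0 = - (z * (c1 + z * poly r z))"
    using poly_s by (simp add: s eq_neg_iff_add_eq_0)
  have "vge (int e) (c1 + z * poly r z)"
  proof (rule vge_add)
    show "vge (int e) c1" using v_c1 by (simp add: vge_def)
    have "vge (int M + 0) (z * poly r z)" using z(1) rz(1) by (intro vge_mult) (auto simp: O_iff)
    then show "vge (int e) (z * poly r z)" by (rule vge_mono) (use e(2) in simp)
  qed
  then have "vge (int (M + e)) c0"
    unfolding c0 using vge_mult[OF z(1)] by (auto intro: vge_uminus)
  then obtain w0 where w0: "w0 \<in> A'" "c0 = t ^ (M + e) * w0"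
    using key[OF c(1)] e(3) by blast
  \<comment> \<open>The exponent \<open>M - e\<close> is what remains of \<open>2 * M\<close> after
    division by \<open>t ^ (M + e)\<close>.\<close>
  define h where "h = [:w0, w:] + smult (t ^ (M - e)) ([:0, 0, 1:] * pcompose r [:0, t ^ M:])"
  have "h \<in> polys_over A'"
    unfolding h_def using w(1) w0(1) polys_over_mono[OF A(3) r] tA' is_subring_zero[OF A'(1)] is_subring_one[OF A'(1)]
    by (intro polys_over_add[OF A'(1)] polys_over_smult[OF A'(1)] polys_over_mult[OF A'(1)]
          polys_over_pcompose[OF A'(1)])
      (auto simp: polys_over_pCons[OF A'(1)] polys_over_0[OF A'(1)] intro: is_subring_power[OF A'(1)])
  moreover have "t ^ (M + e) * poly h y = 0"
  proof -
    have M: "t ^ (M + e) * t ^ (M - e) = t ^ M * t ^ M" using e(2) by (simp flip: power_add)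
    have "t ^ (M + e) * poly h y =
        t ^ (M + e) * w0 + t ^ M * y * (t ^ e * w) + (t ^ (M + e) * t ^ (M - e)) * (y * y) * poly r z"
      by (simp add: h_def poly_pcompose z_def power_add algebra_simps)
    also have "\<dots> = c0 + z * c1 + z * z * poly r z"
      unfolding M using w0(2) w(2) by (simp add: z_def algebra_simps)
    finally show ?thesis by (simp add: c0 algebra_simps)
  qed
  then have "poly h y = 0" by simp
  moreover have "poly (pderiv h) y \<noteq> 0 \<and> v (poly (pderiv h) y) = v w"
  proof -
    define f where "f = 2 * y * poly r z + y * y * (t ^ M * poly (pderiv r) z)"
    \<comment> \<open>As \<open>M - e\<close> is positive, the derivative is congruent to
      \<open>w\<close> modulo \<open>t\<close>. Here \<open>w\<close> is a unit, because
      \<open>c1 = t ^ e * w\<close> has valuation \<open>e\<close>.\<close>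
    have eq: "poly (pderiv h) y = w + t ^ (M - e) * f"
      by (simp add: h_def pderiv_add pderiv_smult pderiv_mult pderiv_pcompose pderiv_pCons poly_pcompose
          f_def z_def algebra_simps)
    have w_0: "w \<noteq> 0" "v w = 0" using v_c1 w(2) by (auto simp: v_mult v_power)
    have "f \<in> \<O>"
      unfolding f_def using rz x(3) \<open>2 \<in> \<O>\<close> t_O
      by (auto intro!: is_subringD[OF \<O>] is_subring_power[OF \<O>])
    then have "vge (int (M - e)) (t ^ (M - e) * f)" using vge_iff by blast
    then have "vge (v w + 1) (t ^ (M - e) * f)" by (rule vge_mono) (use e(2) w_0 in simp)
    then show ?thesis using v_add_eq[OF w_0(1)] unfolding eq by blast
  qed
  moreover have "v w = 0" using v_c1 w(2) by (auto simp: v_mult v_power)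
  ultimately show ?thesis by auto
qed

text \<open>Thanks to this, the truncation property of a generated ring need only be checked on its
  generators.\<close>

lemma truncation_subring:
  assumes A': "is_subring A'" "Kt \<subseteq> A'"
  shows "is_subring {d + t ^ k * b |d b. d \<in> Kt \<and> b \<in> A'}" (is "is_subring ?Q")
  unfolding is_subring_def
proof (intro conjI ballI)
  show "1 \<in> ?Q"
    using is_subring_one[OF Kt] is_subring_zero[OF A'(1)] by (intro CollectI exI[of _ 1] exI[of _ 0]) auto
next
  fix x y assume "x \<in> ?Q" "y \<in> ?Q"
  then obtain c d c' d' where *: "c \<in> Kt" "d \<in> A'" "c' \<in> Kt" "d' \<in> A'" "x = c + t ^ k * d" "y = c' + t ^ k * d'"
    by blast
  have "x - y = (c - c') + t ^ k * (d - d')" "x * y = (c * c') + t ^ k * (c * d' + c' * d + t ^ k * d * d')"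
    using * by (auto simp: algebra_simps)
  moreover have "c - c' \<in> Kt" "c * c' \<in> Kt"
    using * by (auto intro: is_subringD[OF Kt])
  moreover have "c \<in> A'" "c' \<in> A'" "t \<in> A'" using * A'(2) t_Kt by auto
  then have "d - d' \<in> A'" "c * d' + c' * d + t ^ k * d * d' \<in> A'"
    using * by (auto intro!: is_subringD[OF A'(1)] is_subring_power[OF A'(1)])
  ultimately show "x - y \<in> ?Q" "x * y \<in> ?Q"
    by blast+
qed

text \<open>The equations are triangular, so the Jacobian determinant is the product of the diagonal
  derivatives, all units. The same equations show one after another that the \<open>\<eta>s\<close>
  are algebraic over \<open>K(T)\<close>, so the independent set \<open>T\<close> is a transcendence
  basis.\<close>

lemma uniformizableI:
  assumes T: "finite T" "T \<subseteq> \<O>" "alg_independent K T"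
    and \<eta>: "set \<eta>s \<subseteq> \<O>" "set \<zeta>s \<subseteq> set \<eta>s" "gen_subfield (K \<union> T \<union> set \<eta>s) = UNIV"
    and q: "\<And>i. i < length \<eta>s \<Longrightarrow> \<exists>q\<in>polys_over (gen_subring (K \<union> T \<union> set (take i \<eta>s))).
      poly q (\<eta>s ! i) = 0 \<and> poly (pderiv q) (\<eta>s ! i) \<noteq> 0 \<and> v (poly (pderiv q) (\<eta>s ! i)) = 0"
  shows "uniformizable K P \<zeta>s"
proof -
  define n where "n = length \<eta>s"
  define \<eta> where "\<eta> = (\<lambda>i. \<eta>s ! i)"
  define R where "R = gen_subring (K \<union> T)"
  have R: "is_subring R" by (simp add: R_def gen_subring_is_subring)
  \<comment> \<open>The place is finite on all of \<open>K\<close>, so the coefficient ring in the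
    definition of uniformizability is \<open>R\<close>.\<close>
  have K_inter: "K \<inter> \<O> = K" using K_subset_O by blast
  have take_eq: "set (take i \<eta>s) = \<eta> ` {..<i}" if "i \<le> n" for i
    using that nth_image[of i \<eta>s] by (simp add: \<eta>_def n_def lessThan_atLeast0)
  have ex_f: "\<exists>f. f \<in> mp_over R {..i} \<and> mp_eval \<eta> f = 0 \<and> mp_eval \<eta> (mp_pderiv i f) \<noteq> 0 \<and>
      v (mp_eval \<eta> (mp_pderiv i f)) = 0" if i: "i < n" for i
  proof -
    obtain q where q: "q \<in> polys_over (gen_subring (K \<union> T \<union> set (take i \<eta>s)))"
      "poly q (\<eta> i) = 0" "poly (pderiv q) (\<eta> i) \<noteq> 0" "v (poly (pderiv q) (\<eta> i)) = 0"
      using assms(7)[of i] i by (auto simp: n_def \<eta>_def)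
    have "K \<union> T \<subseteq> R" unfolding R_def by (rule gen_subring_incl)
    then have "gen_subring (K \<union> T \<union> set (take i \<eta>s)) \<subseteq> gen_subring (R \<union> \<eta> ` {..<i})"
      using i by (intro gen_subring_mono) (auto simp: take_eq)
    then have "coeff q k \<in> gen_subring (R \<union> \<eta> ` {..<i})" for k
      using q(1) by (auto simp: polys_over_def)
    then obtain f where "f \<in> mp_over R (insert i {..<i})" "mp_eval \<eta> f = poly q (\<eta> i)"
      "mp_eval \<eta> (mp_pderiv i f) = poly (pderiv q) (\<eta> i)"
      using multipoly_of_poly[OF R, of q \<eta> "{..<i}" i] by blast
    moreover have "insert i {..<i} = {..i}" by auto
    ultimately show ?thesis using q by auto
  qed
  then obtain f where f: "\<And>i. i < n \<Longrightarrow> f i \<in> mp_over R {..i}" "\<And>i. i < n \<Longrightarrow> mp_eval \<eta> (f i) = 0"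
    "\<And>i. i < n \<Longrightarrow> mp_eval \<eta> (mp_pderiv i (f i)) \<noteq> 0"
    "\<And>i. i < n \<Longrightarrow> v (mp_eval \<eta> (mp_pderiv i (f i))) = 0"
    by metis
  have tri: "j \<notin> mp_vars (f i)" if "i < n" "i < j" for i j
    using f(1)[OF that(1)] that(2) by (auto simp: mp_over_def)
  have trans: "transcendence_basis K T"
    unfolding transcendence_basis_def
  proof (intro conjI T(3))
    define L where "L = gen_subfield (K \<union> T)"
    define A where "A = {x. algebraic_over L x}"
    have L: "is_subfield L" by (simp add: L_def gen_subfield_is_subfield)
    have A: "is_subfield A" unfolding A_def by (rule algebraic_elements_is_subfield[OF L])
    have KT_A: "K \<union> T \<subseteq> A"
      using algebraic_over_base[OF is_subfield_subring[OF L]] gen_subfield_incl[of "K \<union> T"]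
      by (auto simp: A_def L_def)
    \<comment> \<open>Each new element is a root of a polynomial over elements already algebraic
      over \<open>L\<close>; the polynomial is nonzero because its derivative does not vanish at the
      root.\<close>
    have "set (take i \<eta>s) \<subseteq> A" if "i \<le> n" for i
      using that
    proof (induction i)
      case (Suc i)
      then have IH: "set (take i \<eta>s) \<subseteq> A" and i: "i < length \<eta>s" by (auto simp: n_def)
      obtain q where q: "q \<in> polys_over (gen_subring (K \<union> T \<union> set (take i \<eta>s)))"
        "poly q (\<eta>s ! i) = 0" "poly (pderiv q) (\<eta>s ! i) \<noteq> 0"
        using assms(7)[OF i] by blast
      have "gen_subring (K \<union> T \<union> set (take i \<eta>s)) \<subseteq> A"
        using KT_A IH by (intro gen_subring_least is_subfield_subring[OF A]) auto
      then have "\<forall>i. coeff q i \<in> A" using q(1) by (auto simp: polys_over_def)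
      moreover have "q \<noteq> 0" using q(3) by auto
      ultimately have "algebraic_over A (\<eta>s ! i)" using q(2) by (auto simp: algebraic_over_def)
      then have "\<eta>s ! i \<in> A" unfolding A_def using algebraic_over_trans[OF L] by blast
      then show ?case using IH i by (simp add: take_Suc_conv_app_nth)
    qed simp
    from this[of n] have "set \<eta>s \<subseteq> A" by (simp add: n_def)
    then have "gen_subfield (K \<union> T \<union> set \<eta>s) \<subseteq> A" using KT_A by (intro gen_subfield_least A) auto
    then show "\<forall>x. algebraic_over (gen_subfield (K \<union> T)) x"
      using \<eta>(3) by (auto simp: A_def L_def)
  qed
  define J where "J = mat n n (\<lambda>(i, j). mp_eval \<eta> (mp_pderiv j (f i)))"
  have "mp_eval \<eta> (mp_pderiv j (f i)) = 0" if "i < j" "j < n" for i j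
    using that tri[of i j] by (intro mp_eval_pderiv_notin_vars) simp
  then have "det J = prod_list (diag_mat J)"
    by (intro det_lower_triangular[of n]) (auto simp: J_def)
  also have "\<dots> = (\<Prod>i<n. mp_eval \<eta> (mp_pderiv i (f i)))"
    by (subst prod_list_diag_prod) (auto simp: J_def lessThan_atLeast0 intro!: prod.cong)
  finally have det: "det J = (\<Prod>i<n. mp_eval \<eta> (mp_pderiv i (f i)))" .
  have "m \<le> n \<Longrightarrow> (\<Prod>i<m. mp_eval \<eta> (mp_pderiv i (f i))) \<noteq> 0 \<and> v (\<Prod>i<m. mp_eval \<eta> (mp_pderiv i (f i))) = 0" for m
    by (induction m) (use f(3,4) in \<open>auto simp: v_mult\<close>)
  from this[of n] have "P (det J) \<noteq> Some 0" by (simp add: det P_0_iff vge_def)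
  then show ?thesis
    unfolding uniformizable_def Let_def
    using T \<eta> trans tri f(1,2) mp_over_mono[of _ R _ R "{..<n}"]
    by (intro exI[of _ T] exI[of _ \<eta>s] exI[of _ f])
      (auto simp: K_inter J_def \<eta>_def n_def R_def intro!: mp_over_mono[OF f(1), unfolded n_def])
qed

text \<open>The separating enumeration is dilated entry by entry. The first \<open>s\<close> dilated
  elements join \<open>t\<close> in the transcendence basis, the others are roots of the equations
  with unit derivative.\<close>

lemma uniformizable_if_generated:
  assumes "finite S" "t \<notin> S" "S \<subseteq> \<O>" and gen: "gen_subfield (K \<union> insert t S) = UNIV"
    and \<zeta>s: "set \<zeta>s \<subseteq> insert t S"
  shows "uniformizable K P \<zeta>s"
proof -
  obtain xs s where xs: "set xs = S" "distinct xs" "s \<le> length xs"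
    and indep: "alg_independent K (insert t (set (take s xs)))"
    and ex_q: "\<forall>i\<in>{s..<length xs}. \<exists>q. (\<forall>k. coeff q k \<in> gen_subring (K \<union> insert t (set (take i xs)))) \<and>
       poly q (xs ! i) = 0 \<and> poly (pderiv q) (xs ! i) \<noteq> 0"
    using separating_enumeration[OF assms(1,2)] by blast
  define n where "n = length xs"
  define x where "x = (\<lambda>i. xs ! i)"
  define B where "B = (\<lambda>i. gen_subring (K \<union> insert t (x ` {..<i})))"
  have take_eq: "set (take i xs) = x ` {..<i}" if "i \<le> n" for i
    using that nth_image[of i xs] by (simp add: x_def n_def lessThan_atLeast0)
  have S_eq: "S = x ` {..<n}" using take_eq[of n] xs(1) by (simp add: n_def)
  have "\<exists>q. q \<in> polys_over (B i) \<and> poly q (x i) = 0 \<and> poly (pderiv q) (x i) \<noteq> 0"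
    if "s \<le> i" "i < n" for i
    using bspec[OF ex_q, of i] that take_eq[of i] by (simp add: polys_over_def B_def x_def n_def)
  then obtain q where q: "\<And>i. s \<le> i \<Longrightarrow> i < n \<Longrightarrow> q i \<in> polys_over (B i)"
    "\<And>i. s \<le> i \<Longrightarrow> i < n \<Longrightarrow> poly (q i) (x i) = 0"
    "\<And>i. s \<le> i \<Longrightarrow> i < n \<Longrightarrow> poly (pderiv (q i)) (x i) \<noteq> 0" by metis
  have x_O: "x i \<in> \<O>" if "i < n" for i using S_eq assms(3) that by auto
  define e where "e = (\<lambda>i. nat (v (poly (pderiv (q i)) (x i))))"
  \<comment> \<open>A common strict bound for the \<open>e i\<close>. For \<open>i < s\<close> the
    number \<open>e i\<close> is unspecified and merely enlarges the bound.\<close>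
  define E where "E = Suc (\<Sum>i<n. e i)"
  \<comment> \<open>The \<open>i\<close>-th dilatation needs \<open>M i > e i\<close>, and \<open>M j \<ge> M i + e i\<close> for all \<open>j < i\<close>.\<close>
  define M where "M = (\<lambda>i. E * (n - i))"
  have e_less: "e i < E" if "i < n" for i
    using that member_le_sum[of i "{..<n}" e] by (simp add: E_def less_Suc_eq_le)
  have E_le: "E \<le> M i" if "i < n" for i
    using that by (cases "n - i") (auto simp: M_def)
  have M_le: "M i + E \<le> M j" if "j < i" "i < n" for i j
  proof -
    have "M i + E = E * Suc (n - i)" by (simp add: M_def)
    also have "\<dots> \<le> M j" unfolding M_def using that by (intro mult_le_mono2) simp
    finally show ?thesis .
  qed
  \<comment> \<open>The independent \<open>x i\<close> with \<open>i < s\<close> are dilated as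
    well, since the later equations need them truncated modulo high powers of
    \<open>t\<close>.\<close>
  have "\<exists>a y. a \<in> Kt \<and> y \<in> \<O> \<and> x i = a + t ^ M i * y" if "i < n" for i
    using Kt_truncation[OF x_O[OF that], of "M i"] by blast
  then obtain a y where a: "\<And>i. i < n \<Longrightarrow> a i \<in> Kt" and y: "\<And>i. i < n \<Longrightarrow> y i \<in> \<O>"
    and x_eq: "\<And>i. i < n \<Longrightarrow> x i = a i + t ^ M i * y i" by metis
  define A where "A = (\<lambda>i. gen_subring (K \<union> insert t (y ` {..<i})))"
  have A: "is_subring (A i)" for i by (simp add: A_def gen_subring_is_subring)
  have Kt_A: "Kt \<subseteq> A i" for i unfolding A_def by (intro gen_subring_mono) auto
  have y_A: "y j \<in> A i" if "j < i" for i j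
    using that gen_subring_incl[of "K \<union> insert t (y ` {..<i})"] by (auto simp: A_def)
  have A_O: "A i \<subseteq> \<O>" if "i \<le> n" for i
    unfolding A_def using y that K_subset_O t_O by (intro gen_subring_least \<O>) auto
  have Kt_B: "Kt \<subseteq> B i" for i unfolding B_def by (intro gen_subring_mono) auto
  have K_A: "K \<subseteq> A i" and t_A: "t \<in> A i" for i using Kt_A[of i] K_Kt t_Kt by auto
  have x_A: "x j \<in> A i" if "j < i" "j < n" for i j
    unfolding x_eq[OF that(2)] using a[OF that(2)] Kt_A[of i] y_A[OF that(1)] t_A[of i]
    by (intro is_subring_add[OF A] is_subring_mult[OF A] is_subring_power[OF A]) auto
  have B_A: "B i \<subseteq> A i" if "i \<le> n" for i
    unfolding B_def using x_A that K_A[of i] t_A[of i] by (intro gen_subring_least A) auto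
  have trunc: "\<exists>d\<in>Kt. \<exists>b\<in>A i. c = d + t ^ (M i + E) * b" if i: "i < n" and c: "c \<in> B i" for i c
  proof -
    define Q where "Q = {d + t ^ (M i + E) * b |d b. d \<in> Kt \<and> b \<in> A i}"
    have Q: "is_subring Q" unfolding Q_def by (rule truncation_subring[OF A Kt_A])
    have Kt_Q: "Kt \<subseteq> Q"
    proof
      fix d assume "d \<in> Kt"
      then show "d \<in> Q"
        unfolding Q_def using is_subring_zero[OF A, of i] by (intro CollectI exI[of _ d] exI[of _ 0]) auto
    qed
    \<comment> \<open>For \<open>j < i\<close> the difference \<open>x j - a j\<close> is
      \<open>t ^ M j * y j\<close>, where \<open>M j\<close> is at least \<open>M i + E\<close> and
      \<open>y j\<close> lies in \<open>A i\<close>.\<close>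
    have "x ` {..<i} \<subseteq> Q"
    proof
      fix z assume "z \<in> x ` {..<i}"
      then obtain j where j: "j < i" "z = x j" by blast
      then have jn: "j < n" using i by simp
      have "t ^ M j = t ^ (M i + E) * t ^ (M j - (M i + E))"
        using M_le[OF j(1) i] by (simp flip: power_add)
      then have "z = a j + t ^ (M i + E) * (t ^ (M j - (M i + E)) * y j)"
        using x_eq[OF jn] j(2) by (simp add: mult.assoc)
      moreover have "t ^ (M j - (M i + E)) * y j \<in> A i"
        using y_A[OF j(1)] t_A[of i] by (intro is_subring_mult[OF A] is_subring_power[OF A])
      ultimately show "z \<in> Q" using a[OF jn] unfolding Q_def by blast
    qed
    then have "B i \<subseteq> Q"
      unfolding B_def using Kt_Q K_Kt t_Kt by (intro gen_subring_least Q) blast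
    then have "c \<in> Q" using c by blast
    then show ?thesis unfolding Q_def by blast
  qed
  have ex_h: "\<exists>h\<in>polys_over (A i). poly h (y i) = 0 \<and> v (poly (pderiv h) (y i)) = 0 \<and> poly (pderiv h) (y i) \<noteq> 0"
    if i: "s \<le> i" "i < n" for i
  proof (rule dilatation[of "B i" "A i" "M i + E" "q i" "x i" "e i" "M i" "a i"])
    show "is_subring (B i)" by (simp add: B_def gen_subring_is_subring)
    have q_O: "q i \<in> polys_over \<O>"
      using q(1)[OF i] polys_over_mono B_A[of i] A_O[of i] i(2) by (meson less_imp_le subset_trans)
    have "poly (pderiv (q i)) (x i) \<in> \<O>"
      by (rule poly_in_subring[OF \<O> polys_over_pderiv[OF \<O> q_O] x_O[OF i(2)]])
    then show "v (poly (pderiv (q i)) (x i)) = int (e i)"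
      using q(3)[OF i] by (simp add: e_def O_iff vge_def)
    show "e i < M i" "M i + e i \<le> M i + E" using e_less[OF i(2)] E_le[OF i(2)] by auto
    show "B i \<subseteq> A i" "A i \<subseteq> \<O>" using B_A[of i] A_O[of i] i(2) by auto
  qed (fact Kt_B A trunc[OF i(2)] q(1)[OF i] q(2)[OF i] q(3)[OF i] x_eq[OF i(2)] a[OF i(2)] y[OF i(2)])+
  define T where "T = insert t (y ` {..<s})"
  \<comment> \<open>The \<open>\<zeta>s\<close> are appended last: they lie in \<open>A n\<close>,
    so each satisfies a linear equation with derivative one.\<close>
  define \<eta>s where "\<eta>s = map y [s..<n] @ \<zeta>s"
  have sn: "s \<le> n" using xs(3) by (simp add: n_def)
  have T_indep: "alg_independent K (insert t (y ` {..<m}))" if "m \<le> s" for m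
    using that
  proof (induction m)
    case 0
    show ?case using alg_independent_mono[OF indep, of "{t}"] by simp
  next
    case (Suc m)
    then have m: "m < s" "m < n" using sn by auto
    \<comment> \<open>\<open>L\<close> contains the earlier \<open>y j\<close>, each being
      \<open>(x j - a j) / t ^ M j\<close>. If \<open>y m\<close> were algebraic over
      \<open>L\<close>, so would be \<open>x m\<close>, against the independence of \<open>t\<close>
      and the first \<open>s\<close> entries.\<close>
    define L where "L = gen_subfield (K \<union> insert t (x ` {..<m}))"
    have L: "is_subfield L" by (simp add: L_def gen_subfield_is_subfield)
    note LR = is_subfield_subring[OF L]
    have L_incl: "K \<union> insert t (x ` {..<m}) \<subseteq> L" unfolding L_def by (rule gen_subfield_incl)
    then have Kt_L: "Kt \<subseteq> L" by (intro gen_subring_least LR) auto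
    have "y j \<in> L" if j: "j < m" for j
    proof -
      have jn: "j < n" using j m by simp
      have "y j = (x j - a j) / t ^ M j" using x_eq[OF jn] by simp
      also have "\<dots> \<in> L"
        using a[OF jn] Kt_L L_incl j
        by (intro is_subfield_divide[OF L] is_subring_diff[OF LR] is_subring_power[OF LR]) auto
      finally show ?thesis .
    qed
    then have y_L: "gen_subfield (K \<union> insert t (y ` {..<m})) \<subseteq> L"
      using L_incl by (intro gen_subfield_least L) auto
    have "\<not> algebraic_over (gen_subfield (K \<union> insert t (y ` {..<m}))) (y m)"
    proof
      assume "algebraic_over (gen_subfield (K \<union> insert t (y ` {..<m}))) (y m)"
      then have y_alg: "algebraic_over L (y m)" using y_L by (rule algebraic_over_mono)
      note alg = is_subfield_subring[OF algebraic_elements_is_subfield[OF L]]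
      have L_alg: "L \<subseteq> {x. algebraic_over L x}" using algebraic_over_base[OF LR] by blast
      have "x m \<in> {x. algebraic_over L x}"
        unfolding x_eq[OF m(2)] using y_alg a[OF m(2)] Kt_L L_alg t_Kt
        by (intro is_subring_add[OF alg] is_subring_mult[OF alg] is_subring_power[OF alg]) auto
      moreover have "x m \<notin> insert t (x ` {..<m})"
        using m xs(1,2) assms(2) by (auto simp: x_def n_def nth_eq_iff_index_eq dest: nth_mem)
      ultimately have "\<not> alg_independent K (insert (x m) (insert t (x ` {..<m})))"
        using algebraic_imp_not_alg_independent_insert[OF K] by (simp add: L_def)
      moreover have "insert (x m) (insert t (x ` {..<m})) \<subseteq> insert t (set (take s xs))"
        unfolding take_eq[OF sn] using m by auto
      ultimately show False using alg_independent_mono[OF indep] by blast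
    qed
    then have "alg_independent K (insert (y m) (insert t (y ` {..<m})))"
      using Suc m by (intro alg_independent_insertI[OF K, of "insert t (y ` {..<m})"]) simp_all
    moreover have "insert (y m) (insert t (y ` {..<m})) = insert t (y ` {..<Suc m})"
      by (auto simp: lessThan_Suc)
    ultimately show ?case by simp
  qed
  have \<eta>_take: "K \<union> T \<union> set (take i \<eta>s) = K \<union> insert t (y ` {..<s + i})" if "i \<le> n - s" for i
  proof -
    have "take i \<eta>s = map y [s..<s + i]"
      using that sn by (simp add: \<eta>s_def take_map)
    moreover have "{..<s + i} = {..<s} \<union> {s..<s + i}" by auto
    ultimately show ?thesis by (simp add: T_def image_Un Un_assoc)
  qed
  have A_n: "A n \<subseteq> gen_subring (K \<union> T \<union> set (take i \<eta>s))" if "n - s \<le> i" for i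
  proof -
    have "set (take (n - s) \<eta>s) \<subseteq> set (take i \<eta>s)" using that by (rule set_take_subset_set_take)
    then have "K \<union> insert t (y ` {..<n}) \<subseteq> K \<union> T \<union> set (take i \<eta>s)"
      using \<eta>_take[of "n - s"] sn by auto
    then show ?thesis unfolding A_def by (rule gen_subring_mono)
  qed
  have S_A: "insert t S \<subseteq> A n" using x_A t_A[of n] by (auto simp: S_eq)
  show ?thesis
  proof (rule uniformizableI[of T \<eta>s])
    show "finite T" by (simp add: T_def)
    show "T \<subseteq> \<O>" using y sn t_O by (auto simp: T_def)
    show "alg_independent K T" unfolding T_def using T_indep by blast
    show "set \<eta>s \<subseteq> \<O>" using y \<zeta>s assms(3) t_O by (auto simp: \<eta>s_def)
    show "set \<zeta>s \<subseteq> set \<eta>s" by (simp add: \<eta>s_def)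
    have "A n \<subseteq> gen_subring (K \<union> T \<union> set \<eta>s)" using A_n[of "length \<eta>s"] by (simp add: \<eta>s_def)
    also have "\<dots> \<subseteq> gen_subfield (K \<union> T \<union> set \<eta>s)" by (rule gen_subring_subset_gen_subfield)
    finally have "K \<union> insert t S \<subseteq> gen_subfield (K \<union> T \<union> set \<eta>s)"
      using S_A K_A[of n] by blast
    then show "gen_subfield (K \<union> T \<union> set \<eta>s) = UNIV"
      using gen gen_subfield_least[OF gen_subfield_is_subfield] by blast
  next
    fix i assume i: "i < length \<eta>s"
    show "\<exists>q\<in>polys_over (gen_subring (K \<union> T \<union> set (take i \<eta>s))).
      poly q (\<eta>s ! i) = 0 \<and> poly (pderiv q) (\<eta>s ! i) \<noteq> 0 \<and> v (poly (pderiv q) (\<eta>s ! i)) = 0"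
    proof (cases "i < n - s")
      case True
      then have si: "s \<le> s + i" "s + i < n" by auto
      have "\<eta>s ! i = y (s + i)" using True by (simp add: \<eta>s_def nth_append)
      moreover have "gen_subring (K \<union> T \<union> set (take i \<eta>s)) = A (s + i)"
        using \<eta>_take[of i] True by (simp add: A_def)
      moreover obtain h where "h \<in> polys_over (A (s + i))" "poly h (y (s + i)) = 0"
        "v (poly (pderiv h) (y (s + i))) = 0" "poly (pderiv h) (y (s + i)) \<noteq> 0"
        using ex_h[OF si] by blast
      ultimately show ?thesis by (intro bexI[of _ h]) simp_all
    next
      case False
      let ?R = "gen_subring (K \<union> T \<union> set (take i \<eta>s))"
      have R: "is_subring ?R" by (rule gen_subring_is_subring)
      have "\<eta>s ! i \<in> set \<zeta>s" using False i by (auto simp: \<eta>s_def nth_append)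
      moreover have "A n \<subseteq> ?R" using A_n[of i] False by simp
      ultimately have "\<eta>s ! i \<in> ?R" using \<zeta>s S_A by blast
      then have "[:- (\<eta>s ! i), 1:] \<in> polys_over ?R"
        using is_subring_uminus[OF R] is_subring_one[OF R]
        by (simp add: polys_over_pCons[OF R] polys_over_0[OF R])
      then show ?thesis by (rule rev_bexI) (simp add: pderiv_pCons)
    qed
  qed
qed

end

section \<open>Passage to generators in the valuation ring\<close>

theorem theorem1p8:
  fixes K :: "'a::field set" and P :: "'a \<Rightarrow> 'a option" and \<zeta>s :: "'a list"
  assumes "function_field K"
    and "rational_place_over K P"
    and "discrete_place P"
    and "set \<zeta>s \<subseteq> val_ring P"
  shows "uniformizable K P \<zeta>s"
proof -
  have P: "place P" and P_K: "\<And>a. a \<in> K \<Longrightarrow> P a = Some a" and "residue_field P = K"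
    using assms(2) by (auto simp: rational_place_over_def)
  have K: "is_subfield K" and "fin_gen_over K"
    using assms(1) by (auto simp: function_field_def)
  then obtain S0 where S0: "finite S0" "gen_subfield (K \<union> S0) = UNIV"
    by (auto simp: fin_gen_over_def)
  obtain v t where vt: "t \<noteq> 0" "v t = 1"
    "\<And>a b. a \<noteq> 0 \<Longrightarrow> b \<noteq> 0 \<Longrightarrow> v (a * b) = v a + v b"
    "\<And>a. a \<noteq> 0 \<Longrightarrow> a \<in> val_ring P \<longleftrightarrow> 0 \<le> (v a :: int)"
    by (rule discrete_place_valuation[OF P assms(3)]) (rule that; assumption)
  interpret rational_dvr K P v t
  proof
    show "\<And>a c. P a = Some c \<Longrightarrow> c \<in> K"
      using \<open>residue_field P = K\<close> unfolding residue_field_def by blast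
  qed (fact K P P_K vt)+
  \<comment> \<open>A generator outside the valuation ring is replaced by its inverse, which has
    residue zero. The uniformizer is removed because it is adjoined separately.\<close>
  define S where "S = (\<lambda>a. if a \<in> val_ring P then a else inverse a) ` S0 \<union> set \<zeta>s - {t}"
  show ?thesis
  proof (rule uniformizable_if_generated)
    show "finite S" "t \<notin> S" using S0(1) by (auto simp: S_def)
    show "S \<subseteq> val_ring P"
      using assms(4) place_None[OF P] by (auto simp: S_def val_ring_def)
    show "set \<zeta>s \<subseteq> insert t S" by (auto simp: S_def)
    have L: "is_subfield (gen_subfield (K \<union> insert t S))" by (rule gen_subfield_is_subfield)
    have incl: "K \<union> insert t S \<subseteq> gen_subfield (K \<union> insert t S)" by (rule gen_subfield_incl)
    have "a \<in> gen_subfield (K \<union> insert t S)" if "a \<in> S0" for a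
    proof (cases "a \<in> val_ring P")
      case True
      then have "a \<in> insert t S" using that by (auto simp: S_def)
      then show ?thesis using incl by blast
    next
      case False
      then have "inverse a \<in> insert t S" using that by (auto simp: S_def)
      then have "inverse a \<in> gen_subfield (K \<union> insert t S)" using incl by blast
      then have "inverse (inverse a) \<in> gen_subfield (K \<union> insert t S)"
        by (rule is_subfield_inverse[OF L])
      then show ?thesis by simp
    qed
    then have "gen_subfield (K \<union> S0) \<subseteq> gen_subfield (K \<union> insert t S)"
      using incl by (intro gen_subfield_least L) auto
    then show "gen_subfield (K \<union> insert t S) = UNIV" using S0(2) by auto
  qed
qed

end
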